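(* Let $T>0$, $H\in(1/2,1)$, $\beta\in(0,1]$. Assume that $V_0\in C_b^1(\mathbb{R}^n,\mathbb{R}^n)$ and $V_1,\dots,V_d\in C_b^2(\mathbb{R}^n,\mathbb{R}^n)$. For $y>0$ let $X^H(y)$ be the solution of $$X_{t}^{H}(y)=x_{0}+\sqrt{y}\sum_{j=1}^{d}\int_{0}^{t}V_{j}(X_{s}^{H}(y))\,dB_{H}^{j}(s)+\int_{0}^{t}V_{0}(X_{s}^{H}(y))\,ds,\quad t\in[0,T].$$ Then, for each $t\in[0,T]$, $$\left.\int_{0}^{t}V_{j}(X_{s}^{H}(y))\,dB_{H}^{j}(s)\right|_{y=Y_{\beta}}=\int_{0}^{t}V_{j}(X_{s}^{H}(Y_{\beta}))\,dB_{H}^{j}(s),\quad j=1,\ldots,d,$$ and $$\left.\int_{0}^{t}V_{0}(X_{s}^{H}(y))\,ds\right|_{y=Y_{\beta}}=\int_{0}^{t}V_{0}(X_{s}^{H}(Y_{\beta}))\,ds .$$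
   Context: $n,d\ge 1$ are integers and $x_0\in\mathbb{R}^n$ is fixed. On a probability space $(\Omega,\mathcal{F},\mathbb{P})$, $\bm{B}_H=(B_H^1,\dots,B_H^d)$ is a standard $d$-dimensional fractional Brownian motion with Hurst parameter $H$ (independent components, each centered Gaussian with covariance $\frac12(t^{2H}+s^{2H}-|t-s|^{2H})$), and $Y_\beta$ is a non-negative random variable independent of $\bm{B}_H$ whose law has density $M_\beta$ (the $M$-Wright density), characterized by the Laplace transform $\mathbb{E}(e^{-sY_\beta})=\int_0^\infty e^{-s\tau}M_\beta(\tau)\,d\tau=E_\beta(-s)$, $s\ge0$, with $E_\beta(x)=\sum_{k=0}^\infty x^k/\Gamma(\beta k+1)$ the Mittag-Leffler function (for $\beta=1$, $Y_1=1$ a.s.). $C_b^k(\mathbb{R}^n,\mathbb{R}^m)$ is the space of bounded, $k$ times continuously (Fréchet) differentiable functions with bounded derivatives up to order $k$. Integrals with respect to $B_H^j$ are pathwise Riemann–Stieltjes (Young) integrals. $X^H(y)$ denotes the unique solution, with $(1-\lambda)$-Hölder continuous paths for $1-H<\lambda<\frac12$. For each $t$, one uses a modification of $y\mapsto X_t^H(y)$ that is continuous in $y$. $X^H_t(Y_\beta)$ denotes the random variable $\omega\mapsto X^H_t(y)(\omega)|_{y=Y_\beta(\omega)}$, and likewise $(\cdot)|_{y=Y_\beta}$ denotes evaluation of a $y$-indexed family of random variables at $y=Y_\beta(\omega)$. Equalities between random variables are understood almost surely. *)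

theory Defs
  imports "HOL-Probability.Probability"
begin

section \<open>Smooth bounded functions, Hoelder continuity, Riemann--Stieltjes integrals\<close>

text \<open>The spaces \<open>C_b^1\<close> and \<open>C_b^2\<close>; derivatives are Frechet derivatives, and the second
  derivative is the derivative of the map \<open>f'\<close> with values in the bounded linear maps.\<close>

definition Cb1 :: "('a::real_normed_vector \<Rightarrow> 'b::real_normed_vector) \<Rightarrow> bool" where
  "Cb1 f \<longleftrightarrow> bounded (range f) \<and>
     (\<exists>f' :: 'a \<Rightarrow> ('a \<Rightarrow>\<^sub>L 'b). (\<forall>x. (f has_derivative blinfun_apply (f' x)) (at x)) \<and>
        continuous_on UNIV f' \<and> bounded (range f'))"

definition Cb2 :: "('a::real_normed_vector \<Rightarrow> 'b::real_normed_vector) \<Rightarrow> bool" where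
  "Cb2 f \<longleftrightarrow> bounded (range f) \<and>
     (\<exists>f' :: 'a \<Rightarrow> ('a \<Rightarrow>\<^sub>L 'b). (\<forall>x. (f has_derivative blinfun_apply (f' x)) (at x)) \<and> Cb1 f')"

definition holder_on :: "real \<Rightarrow> real set \<Rightarrow> (real \<Rightarrow> 'b::metric_space) \<Rightarrow> bool" where
  "holder_on \<alpha> S f \<longleftrightarrow> (\<exists>C. \<forall>s\<in>S. \<forall>t\<in>S. dist (f s) (f t) \<le> C * \<bar>s - t\<bar> powr \<alpha>)"

text \<open>Limit of the Riemann--Stieltjes sums as the mesh tends to zero, uniformly in the tags. For
  \<open>K = {u..v}\<close> the increment of \<open>g\<close> over \<open>K\<close> is \<open>g v - g u\<close>; possible degenerate members
  \<open>K = {u}\<close> of a tagged division contribute zero.\<close>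

definition has_RS_integral ::
    "(real \<Rightarrow> 'b::real_normed_vector) \<Rightarrow> (real \<Rightarrow> real) \<Rightarrow> real \<Rightarrow> real \<Rightarrow> 'b \<Rightarrow> bool" where
  "has_RS_integral f g a b I \<longleftrightarrow>
     (\<forall>e>0. \<exists>\<delta>>0. \<forall>p. p tagged_division_of {a..b} \<and> (\<forall>(x, K)\<in>p. diameter K < \<delta>) \<longrightarrow>
        norm ((\<Sum>(x, K)\<in>p. (g (Sup K) - g (Inf K)) *\<^sub>R f x) - I) < e)"

definition RS_integrable ::
    "(real \<Rightarrow> 'b::real_normed_vector) \<Rightarrow> (real \<Rightarrow> real) \<Rightarrow> real \<Rightarrow> real \<Rightarrow> bool" where
  "RS_integrable f g a b \<longleftrightarrow> (\<exists>I. has_RS_integral f g a b I)"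

definition RS_integral ::
    "(real \<Rightarrow> 'b::real_normed_vector) \<Rightarrow> (real \<Rightarrow> real) \<Rightarrow> real \<Rightarrow> real \<Rightarrow> 'b" where
  "RS_integral f g a b = (THE I. has_RS_integral f g a b I)"

lemma has_RS_integral_unique:
  assumes "has_RS_integral f g a b I" "has_RS_integral f g a b J"
  shows "I = J"
proof (rule ccontr)
  assume "I \<noteq> J"
  define e where "e = norm (I - J) / 2"
  have e: "e > 0" using \<open>I \<noteq> J\<close> by (simp add: e_def)
  obtain d1 where d1: "d1 > 0"
    "\<And>p. p tagged_division_of {a..b} \<and> (\<forall>(x, K)\<in>p. diameter K < d1) \<Longrightarrow>
        norm ((\<Sum>(x, K)\<in>p. (g (Sup K) - g (Inf K)) *\<^sub>R f x) - I) < e"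
    using assms(1) e unfolding has_RS_integral_def by meson
  obtain d2 where d2: "d2 > 0"
    "\<And>p. p tagged_division_of {a..b} \<and> (\<forall>(x, K)\<in>p. diameter K < d2) \<Longrightarrow>
        norm ((\<Sum>(x, K)\<in>p. (g (Sup K) - g (Inf K)) *\<^sub>R f x) - J) < e"
    using assms(2) e unfolding has_RS_integral_def by meson
  define d where "d = min d1 d2 / 3"
  have d: "d > 0" "2 * d < d1" "2 * d < d2" using d1(1) d2(1) by (auto simp: d_def)
  have "gauge (\<lambda>x::real. ball x d)" using d(1) by (rule gauge_ball)
  then obtain p where p: "p tagged_division_of {a..b}" "(\<lambda>x. ball x d) fine p"
    using fine_division_exists_real by metis
  have diam: "diameter K \<le> 2 * d" if "(x, K) \<in> p" for x K
  proof -
    have "K \<subseteq> ball x d" using p(2) that by (auto simp: fine_def)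
    then have "diameter K \<le> diameter (ball x d)" by (intro diameter_subset) auto
    then show ?thesis using d(1) by simp
  qed
  let ?S = "\<Sum>(x, K)\<in>p. (g (Sup K) - g (Inf K)) *\<^sub>R f x"
  have "\<forall>(x, K)\<in>p. diameter K < d1" "\<forall>(x, K)\<in>p. diameter K < d2"
    using diam d by force+
  then have "norm (?S - I) < e" "norm (?S - J) < e" using d1(2) d2(2) p(1) by blast+
  moreover have "norm (I - J) \<le> norm (?S - I) + norm (?S - J)"
    using norm_triangle_ineq4[of "?S - J" "?S - I"] by simp
  ultimately show False by (simp add: e_def)
qed

lemma RS_integral_eqI: "has_RS_integral f g a b I \<Longrightarrow> RS_integral f g a b = I"
  unfolding RS_integral_def by (blast intro: has_RS_integral_unique the_equality)

section \<open>Fractional Brownian motion\<close>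

text \<open>Constants count as Gaussian (variance zero).\<close>

definition gaussian_rv :: "'w measure \<Rightarrow> ('w \<Rightarrow> real) \<Rightarrow> bool" where
  "gaussian_rv M Z \<longleftrightarrow> Z \<in> borel_measurable M \<and>
     ((\<exists>\<mu> \<sigma>. 0 < \<sigma> \<and> distributed M lborel Z (normal_density \<mu> \<sigma>)) \<or>
      (\<exists>\<mu>. AE \<omega> in M. Z \<omega> = \<mu>))"

definition gaussian_process :: "'w measure \<Rightarrow> 't set \<Rightarrow> ('t \<Rightarrow> 'w \<Rightarrow> real) \<Rightarrow> bool" where
  "gaussian_process M I Z \<longleftrightarrow>
     (\<forall>F c. finite F \<and> F \<subseteq> I \<longrightarrow> gaussian_rv M (\<lambda>\<omega>. \<Sum>t\<in>F. c t * Z t \<omega>))"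

text \<open>Path continuity, needed for pathwise integration, is part of the notion; Hoelder regularity
  of the paths is not assumed.\<close>

definition fBm :: "'w measure \<Rightarrow> real \<Rightarrow> (real \<Rightarrow> 'w \<Rightarrow> real) \<Rightarrow> bool" where
  "fBm M H b \<longleftrightarrow> gaussian_process M {0..} b \<and>
     (\<forall>t\<ge>0. (\<integral>\<omega>. b t \<omega> \<partial>M) = 0) \<and>
     (\<forall>s\<ge>0. \<forall>t\<ge>0. (\<integral>\<omega>. b s \<omega> * b t \<omega> \<partial>M) =
        (t powr (2 * H) + s powr (2 * H) - \<bar>t - s\<bar> powr (2 * H)) / 2) \<and>
     (AE \<omega> in M. continuous_on {0..} (\<lambda>t. b t \<omega>))"

definition fBm_vec :: "'w measure \<Rightarrow> real \<Rightarrow> (real \<Rightarrow> 'w \<Rightarrow> real ^ 'd) \<Rightarrow> bool" where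
  "fBm_vec M H B \<longleftrightarrow> (\<forall>j. fBm M H (\<lambda>t \<omega>. B t \<omega> $ j)) \<and>
     prob_space.indep_vars M (\<lambda>j. \<Pi>\<^sub>M t\<in>{0::real..}. (borel :: real measure))
       (\<lambda>j \<omega>. \<lambda>t\<in>{0..}. B t \<omega> $ j) (UNIV :: 'd set)"

text \<open>Independence of a random variable and a whole process with time set \<open>{0..}\<close>: the generated
  sigma-algebras are independent. (The library's \<open>indep_var\<close> would force both to have
  the same value type.)\<close>

definition indep_of_process ::
    "'w measure \<Rightarrow> ('w \<Rightarrow> real) \<Rightarrow> (real \<Rightarrow> 'w \<Rightarrow> 'b::topological_space) \<Rightarrow> bool" where
  "indep_of_process M Y B \<longleftrightarrow> prob_space.indep_set M
     (sets (vimage_algebra (space M) Y borel))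
     (sets (vimage_algebra (space M) (\<lambda>\<omega>. \<lambda>t\<in>{0..}. B t \<omega>) (\<Pi>\<^sub>M t\<in>{0..}. borel)))"

section \<open>The M-Wright law\<close>

definition mittag_leffler :: "real \<Rightarrow> real \<Rightarrow> real" where
  "mittag_leffler \<beta> x = (\<Sum>k. x ^ k / Gamma (\<beta> * real k + 1))"

text \<open>The M-Wright density is characterized (up to Lebesgue-null sets) by its Laplace transform.\<close>

definition M_Wright_density :: "real \<Rightarrow> (real \<Rightarrow> real) \<Rightarrow> bool" where
  "M_Wright_density \<beta> m \<longleftrightarrow> m \<in> borel_measurable borel \<and> (\<forall>\<tau>. 0 \<le> m \<tau>) \<and> (\<forall>\<tau><0. m \<tau> = 0) \<and>
     (\<forall>s\<ge>0. set_integrable lborel {0..} (\<lambda>\<tau>. exp (- s * \<tau>) * m \<tau>) \<and>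
        (LINT \<tau>:{0..}|lborel. exp (- s * \<tau>) * m \<tau>) = mittag_leffler \<beta> (- s))"

text \<open>For \<open>\<beta> = 1\<close> the Laplace transform is \<open>exp (- s)\<close>: there is no density and the law is the
  point mass at 1.\<close>

definition M_Wright_distributed :: "'w measure \<Rightarrow> real \<Rightarrow> ('w \<Rightarrow> real) \<Rightarrow> bool" where
  "M_Wright_distributed M \<beta> Y \<longleftrightarrow> Y \<in> borel_measurable M \<and> (AE \<omega> in M. 0 \<le> Y \<omega>) \<and>
     (if \<beta> = 1 then (AE \<omega> in M. Y \<omega> = 1)
      else (\<exists>m. M_Wright_density \<beta> m \<and> distributed M lborel Y m))"

section \<open>The equation, and evaluation of a family of random variables at a random parameter\<close>

definition young_solution ::
    "real \<Rightarrow> real ^ 'n \<Rightarrow> (real ^ 'n \<Rightarrow> real ^ 'n) \<Rightarrow> ('d \<Rightarrow> real ^ 'n \<Rightarrow> real ^ 'n) \<Rightarrow>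
      (real \<Rightarrow> real ^ 'd::finite) \<Rightarrow> real \<Rightarrow> (real \<Rightarrow> real ^ 'n) \<Rightarrow> bool" where
  "young_solution T x0 V0 V b y x \<longleftrightarrow>
     (\<forall>t\<in>{0..T}.
        (\<forall>j. RS_integrable (\<lambda>s. V j (x s)) (\<lambda>s. b s $ j) 0 t) \<and>
        (\<lambda>s. V0 (x s)) integrable_on {0..t} \<and>
        x t = x0 + sqrt y *\<^sub>R (\<Sum>j\<in>UNIV. RS_integral (\<lambda>s. V j (x s)) (\<lambda>s. b s $ j) 0 t)
                 + integral {0..t} (\<lambda>s. V0 (x s)))"

text \<open>A family \<open>(Z y)\<close>, \<open>y > 0\<close>, of random variables determines each \<open>Z y\<close> only up to a null set
  depending on \<open>y\<close>; its value at \<open>y = Y\<close> is therefore taken in a version that is continuous in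
  \<open>y\<close>. If \<open>Y > 0\<close> almost surely, the value does not depend, up to null sets, on the
  version (\<open>evaluated_at_unique\<close>), and it is \<open>Z (Y \<omega>) \<omega>\<close> if \<open>Z\<close> is itself such a version.\<close>

definition continuous_version ::
    "'w measure \<Rightarrow> (real \<Rightarrow> 'w \<Rightarrow> 'b::topological_space) \<Rightarrow> (real \<Rightarrow> 'w \<Rightarrow> 'b) \<Rightarrow> bool" where
  "continuous_version M Z Z' \<longleftrightarrow>
     (\<forall>y>0. Z' y \<in> borel_measurable M \<and> (AE \<omega> in M. Z' y \<omega> = Z y \<omega>)) \<and>
     (AE \<omega> in M. continuous_on {0<..} (\<lambda>y. Z' y \<omega>))"

definition evaluated_at ::
    "'w measure \<Rightarrow> (real \<Rightarrow> 'w \<Rightarrow> 'b::topological_space) \<Rightarrow> ('w \<Rightarrow> real) \<Rightarrow> ('w \<Rightarrow> 'b) \<Rightarrow> bool" where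
  "evaluated_at M Z Y W \<longleftrightarrow>
     (\<exists>Z'. continuous_version M Z Z' \<and> (AE \<omega> in M. Z' (Y \<omega>) \<omega> = W \<omega>))"

lemma continuous_version_unique:
  fixes Z :: "real \<Rightarrow> 'w \<Rightarrow> 'b::t2_space"
  assumes "continuous_version M Z Z1" "continuous_version M Z Z2"
  shows "AE \<omega> in M. \<forall>y>0. Z1 y \<omega> = Z2 y \<omega>"
proof -
  have "AE \<omega> in M. \<forall>q\<in>{q\<in>\<rat>. 0 < q}. Z1 q \<omega> = Z2 q \<omega>"
  proof (rule AE_ball_countable')
    show "countable {q\<in>\<rat>. 0 < (q::real)}"
      by (rule countable_subset[OF _ countable_rat]) auto
    fix q :: real assume "q \<in> {q\<in>\<rat>. 0 < q}"
    then have "AE \<omega> in M. Z1 q \<omega> = Z q \<omega>" "AE \<omega> in M. Z2 q \<omega> = Z q \<omega>"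
      using assms by (auto simp: continuous_version_def)
    then show "AE \<omega> in M. Z1 q \<omega> = Z2 q \<omega>" by eventually_elim simp
  qed
  moreover have "AE \<omega> in M. continuous_on {0<..} (\<lambda>y. Z1 y \<omega>)"
    "AE \<omega> in M. continuous_on {0<..} (\<lambda>y. Z2 y \<omega>)"
    using assms by (auto simp: continuous_version_def)
  ultimately show ?thesis
  proof eventually_elim
    case (elim \<omega>)
    show ?case
    proof (intro allI impI, rule ccontr)
      fix y :: real assume y: "0 < y" and ne: "Z1 y \<omega> \<noteq> Z2 y \<omega>"
      obtain U W where UW: "open U" "open W" "Z1 y \<omega> \<in> U" "Z2 y \<omega> \<in> W" "U \<inter> W = {}"
        using hausdorff[OF ne] by blast
      have "isCont (\<lambda>y. Z1 y \<omega>) y" "isCont (\<lambda>y. Z2 y \<omega>) y"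
        using elim y by (auto simp: continuous_on_eq_continuous_at)
      then have lim: "((\<lambda>y. Z1 y \<omega>) \<longlongrightarrow> Z1 y \<omega>) (nhds y)" "((\<lambda>y. Z2 y \<omega>) \<longlongrightarrow> Z2 y \<omega>) (nhds y)"
        using tendsto_at_iff_tendsto_nhds[of "\<lambda>y. Z1 y \<omega>" y]
          tendsto_at_iff_tendsto_nhds[of "\<lambda>y. Z2 y \<omega>" y]
        unfolding continuous_at by blast+
      have "\<forall>\<^sub>F q in nhds y. 0 < q"
        using y eventually_nhds_in_open[of "{0<..}" y] by simp
      then have "\<forall>\<^sub>F q in nhds y. Z1 q \<omega> \<in> U \<and> Z2 q \<omega> \<in> W \<and> 0 < q"
        using topological_tendstoD[OF lim(1) UW(1,3)] topological_tendstoD[OF lim(2) UW(2,4)]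
        by eventually_elim simp
      then obtain e where e: "e > 0" "\<And>q. dist q y < e \<Longrightarrow> Z1 q \<omega> \<in> U \<and> Z2 q \<omega> \<in> W \<and> 0 < q"
        unfolding eventually_nhds_metric by blast
      obtain q where q: "q \<in> \<rat>" "y < q" "q < y + e" using Rats_dense_in_real[of y "y + e"] e(1) by auto
      then have "Z1 q \<omega> \<in> U" "Z2 q \<omega> \<in> W" "0 < q" using e(2)[of q] by (auto simp: dist_real_def)
      then show False using elim(1) q(1) UW(5) by auto
    qed
  qed
qed

lemma evaluated_at_unique:
  fixes Z :: "real \<Rightarrow> 'w \<Rightarrow> 'b::t2_space"
  assumes "evaluated_at M Z Y W1" "evaluated_at M Z Y W2" and pos: "AE \<omega> in M. 0 < Y \<omega>"
  shows "AE \<omega> in M. W1 \<omega> = W2 \<omega>"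
proof -
  obtain Z1 Z2 where Z: "continuous_version M Z Z1" "AE \<omega> in M. Z1 (Y \<omega>) \<omega> = W1 \<omega>"
    "continuous_version M Z Z2" "AE \<omega> in M. Z2 (Y \<omega>) \<omega> = W2 \<omega>"
    using assms(1,2) by (auto simp: evaluated_at_def)
  show ?thesis
    using continuous_version_unique[OF Z(1,3)] Z(2,4) pos by eventually_elim auto
qed

end

theory Submission
  imports Defs
begin

text \<open>
  For a fixed path of the noise, evaluating the integral at \<open>y = Y \<omega>\<close> and integrating the solution with
  parameter \<open>Y \<omega>\<close> are the same operation. The substance of the theorem is therefore twofold: on an event
  of probability one the integrals have to exist for all real parameters \<open>y > 0\<close> simultaneously, and they
  have to be continuous in \<open>y\<close>, so that the pathwise family is a continuous version of itself, up to a null set.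

  The equation for each single \<open>y\<close> holds off a null set that depends on \<open>y\<close>, so on one event it is available
  for rational \<open>y\<close> only. The passage to all \<open>y\<close> rests on an a priori estimate
  (\<open>a_priori_holder_bound\<close>): all Hoelder solutions of the equation with \<open>y \<le> b\<close> and a given driving path
  share one Hoelder constant of exponent \<open>\<alpha> = 1 - \<kappa> > 1 / 2\<close>. As \<open>y \<mapsto> X y t\<close> is continuous, real
  parameters inherit this constant, and Young's theory then gives existence of the integrals and, from
  pointwise convergence of the integrands, convergence of the integrals (\<open>RS_integral_limit\<close>). The estimates
  of Young's theory come from a sewing lemma (\<open>sewing\<close>), proved by repeated bisection.

  That the paths of the noise are \<open>\<alpha>\<close>-Hoelder, for \<open>\<alpha> < H\<close>, follows from the Gaussian moments of the
  increments by Kolmogorov's argument (\<open>kolmogorov_continuity\<close>, \<open>fBm_holder\<close>). Measurability of the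
  integrals comes from their being limits of Riemann sums. Finally \<open>Y > 0\<close> almost surely, so \<open>Y \<omega>\<close> is one of
  the parameters covered. The drift is treated throughout as a Young integral against time.
\<close>

section \<open>The sewing lemma\<close>

text \<open>The \<open>n\<close>-fold bisection of \<open>{u..v}\<close>, read as a function of the endpoint \<open>t\<close>: the sum of \<open>Xi\<close> over
the dyadic subintervals to the left of \<open>t\<close>, the last one cut off at \<open>t\<close>. Recursion on the interval
instead of explicit partition points lets every estimate below be an induction with a two-way case
distinction at the midpoint.\<close>

primrec sew :: "(real \<Rightarrow> real \<Rightarrow> 'a::real_normed_vector) \<Rightarrow> nat \<Rightarrow> real \<Rightarrow> real \<Rightarrow> real \<Rightarrow> 'a" where
  "sew Xi 0 u v t = Xi u t"
| "sew Xi (Suc n) u v t = (if t \<le> (u + v) / 2 then sew Xi n u ((u + v) / 2) t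
     else sew Xi n u ((u + v) / 2) ((u + v) / 2) + sew Xi n ((u + v) / 2) v t)"

lemma sew_Suc_left: "t \<le> (u + v) / 2 \<Longrightarrow> sew Xi (Suc n) u v t = sew Xi n u ((u + v) / 2) t"
  and sew_Suc_right: "(u + v) / 2 < t \<Longrightarrow>
    sew Xi (Suc n) u v t = sew Xi n u ((u + v) / 2) ((u + v) / 2) + sew Xi n ((u + v) / 2) v t"
  by auto

declare sew.simps(2) [simp del]

text \<open>A constant that depends on \<open>\<theta>\<close> alone. The geometric series contributes
\<open>1 / (1 - 2 powr (1 - \<theta>))\<close>, and \<open>2 powr \<theta>\<close> is the price for replacing the length of a dyadic interval
by the length of a subinterval that contains half of it.\<close>

definition sewing_const :: "real \<Rightarrow> real" where
  "sewing_const \<theta> = 2 powr \<theta> * (3 / (1 - 2 powr (1 - \<theta>)) + 1) + 1"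

lemma half_powr: "((v - u) / 2) powr \<theta> = 2 powr (1 - \<theta>) / 2 * (v - u) powr \<theta>" if "u \<le> (v::real)"
proof -
  have "((v - u) / 2) powr \<theta> = (v - u) powr \<theta> / 2 powr \<theta>" using that by (simp add: powr_divide)
  then show ?thesis by (simp add: powr_diff field_simps)
qed

lemma sewing_const_nonneg:
  assumes "1 < \<theta>" shows "0 \<le> sewing_const \<theta>"
proof -
  have "2 powr (1 - \<theta>) < 1" using assms by (simp add: powr_less_one)
  then show ?thesis by (simp add: sewing_const_def)
qed

locale almost_additive =
  fixes Xi :: "real \<Rightarrow> real \<Rightarrow> 'a::banach" and a b c \<theta> :: real
  assumes \<theta>: "1 < \<theta>" and c: "0 \<le> c"
    and defect: "\<And>u w v. \<lbrakk>a \<le> u; u \<le> w; w \<le> v; v \<le> b\<rbrakk> \<Longrightarrow>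
      norm (Xi u v - Xi u w - Xi w v) \<le> c * (v - u) powr \<theta>"
begin

abbreviation "r \<equiv> 2 powr (1 - \<theta>)"
abbreviation "K0 \<equiv> c / (1 - r)"

lemma r: "0 < r" "r < 1"
  using \<theta> by (auto simp: powr_less_one)

lemma K0: "c \<le> K0" "0 \<le> K0"
proof -
  show "0 \<le> K0" using r c by simp
  have "c * (1 - r) \<le> c * 1" using r c by (intro mult_left_mono) auto
  then show "c \<le> K0" using r by (simp add: field_simps)
qed

lemma Xi_diag: "a \<le> u \<Longrightarrow> u \<le> b \<Longrightarrow> Xi u u = 0"
  using defect[of u u u] by simp

lemma sew_left: "a \<le> u \<Longrightarrow> u \<le> v \<Longrightarrow> v \<le> b \<Longrightarrow> sew Xi n u v u = 0"
  by (induction n arbitrary: u v) (auto simp: Xi_diag sew_Suc_left)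

text \<open>Passing from level \<open>n\<close> to level \<open>n + 1\<close> commits one defect in each of at most \<open>2 ^ n\<close> intervals, and
each of them is at most \<open>c * ((v - u) / 2 ^ n) powr \<theta>\<close>; since \<open>\<theta> > 1\<close>, the total decays
geometrically.\<close>

lemma sew_step:
  assumes "a \<le> u" "u \<le> t" "t \<le> v" "v \<le> b"
  shows "norm (sew Xi (Suc n) u v t - sew Xi n u v t) \<le> c * r ^ n * (v - u) powr \<theta>"
  using assms
proof (induction n arbitrary: u v t)
  case 0
  let ?m = "(u + v) / 2"
  show ?case
  proof (cases "t \<le> ?m")
    case True
    then show ?thesis using c by (simp add: sew_Suc_left)
  next
    case False
    have "norm (Xi u t - Xi u ?m - Xi ?m t) \<le> c * (t - u) powr \<theta>"
      using 0 False by (intro defect) auto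
    also have "\<dots> \<le> c * (v - u) powr \<theta>" using 0 c \<theta> by (intro mult_left_mono powr_mono2) auto
    finally show ?thesis using False by (simp add: sew_Suc_right norm_minus_commute algebra_simps)
  qed
next
  case (Suc n)
  let ?m = "(u + v) / 2"
  have half: "c * r ^ n * ((v - u) / 2) powr \<theta> = c * r ^ Suc n * (v - u) powr \<theta> / 2"
    using Suc.prems by (subst half_powr) auto
  have h1: "?m - u = (v - u) / 2" "v - ?m = (v - u) / 2" by (auto simp: field_simps)
  have nn: "0 \<le> c * r ^ Suc n * (v - u) powr \<theta>" using c r by simp
  show ?case
  proof (cases "t \<le> ?m")
    case True
    have "norm (sew Xi (Suc n) u ?m t - sew Xi n u ?m t) \<le> c * r ^ n * (?m - u) powr \<theta>"
      using Suc.prems True by (intro Suc.IH) auto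
    also have "\<dots> \<le> c * r ^ Suc n * (v - u) powr \<theta>"
      unfolding h1 half using nn by linarith
    finally show ?thesis by (simp only: sew_Suc_left[OF True])
  next
    case False
    then have m: "?m < t" by simp
    have A: "norm (sew Xi (Suc n) u ?m ?m - sew Xi n u ?m ?m) \<le> c * r ^ n * (?m - u) powr \<theta>"
      using Suc.prems False by (intro Suc.IH) auto
    have B: "norm (sew Xi (Suc n) ?m v t - sew Xi n ?m v t) \<le> c * r ^ n * (v - ?m) powr \<theta>"
      using Suc.prems False by (intro Suc.IH) auto
    have "sew Xi (Suc (Suc n)) u v t - sew Xi (Suc n) u v t =
      (sew Xi (Suc n) u ?m ?m - sew Xi n u ?m ?m) + (sew Xi (Suc n) ?m v t - sew Xi n ?m v t)"
      unfolding sew_Suc_right[OF m] by simp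
    also have "norm \<dots> \<le> c * r ^ Suc n * (v - u) powr \<theta> / 2 + c * r ^ Suc n * (v - u) powr \<theta> / 2"
      using norm_triangle_mono[OF A B] unfolding h1 half .
    finally show ?thesis by linarith
  qed
qed

definition sewn :: "real \<Rightarrow> real \<Rightarrow> real \<Rightarrow> 'a" where
  "sewn u v t = lim (\<lambda>n. sew Xi n u v t)"

lemma sewn_limit:
  assumes "a \<le> u" "u \<le> t" "t \<le> v" "v \<le> b"
  shows "(\<lambda>n. sew Xi n u v t) \<longlonglongrightarrow> sewn u v t"
    and "norm (sewn u v t - Xi u t) \<le> K0 * (v - u) powr \<theta>"
proof -
  let ?d = "\<lambda>n. sew Xi (Suc n) u v t - sew Xi n u v t"
  have bd: "norm (?d n) \<le> r ^ n * (c * (v - u) powr \<theta>)" for n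
    using sew_step[OF assms, of n] by (simp add: mult_ac)
  have S: "(\<lambda>n. r ^ n * (c * (v - u) powr \<theta>)) sums (1 / (1 - r) * (c * (v - u) powr \<theta>))"
    using r by (intro sums_mult2 geometric_sums) auto
  then have sm: "summable (\<lambda>n. r ^ n * (c * (v - u) powr \<theta>))" by (rule sums_summable)
  have sd: "summable ?d" by (rule summable_comparison_test'[OF sm]) (use bd in auto)
  have eq: "(\<Sum>i<n. ?d i) = sew Xi n u v t - Xi u t" for n
    using sum_lessThan_telescope[of "\<lambda>n. sew Xi n u v t" n] by simp
  have "(\<lambda>n. (\<Sum>i<n. ?d i)) \<longlonglongrightarrow> suminf ?d" using summable_LIMSEQ[OF sd] .
  then have "(\<lambda>n. sew Xi n u v t - Xi u t) \<longlonglongrightarrow> suminf ?d" unfolding eq .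
  from tendsto_add[OF this tendsto_const[of "Xi u t"]]
  have L: "(\<lambda>n. sew Xi n u v t) \<longlonglongrightarrow> suminf ?d + Xi u t" by simp
  then have "sewn u v t = suminf ?d + Xi u t" unfolding sewn_def by (rule limI)
  moreover have "norm (suminf ?d) \<le> K0 * (v - u) powr \<theta>"
    using norm_suminf_le[OF bd sm] sums_unique[OF S] by simp
  ultimately show "(\<lambda>n. sew Xi n u v t) \<longlonglongrightarrow> sewn u v t"
    "norm (sewn u v t - Xi u t) \<le> K0 * (v - u) powr \<theta>" using L by auto
qed

lemma sewn_descend_left:
  assumes "a \<le> u" "u \<le> t" "t \<le> (u + v) / 2" "v \<le> b"
  shows "sewn u v t = sewn u ((u + v) / 2) t"
proof -
  have "(\<lambda>n. sew Xi (Suc n) u v t) \<longlonglongrightarrow> sewn u v t"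
    using assms by (intro LIMSEQ_Suc sewn_limit(1)) auto
  moreover have "(\<lambda>n. sew Xi n u ((u + v) / 2) t) \<longlonglongrightarrow> sewn u ((u + v) / 2) t"
    using assms by (intro sewn_limit(1)) auto
  ultimately show ?thesis using LIMSEQ_unique assms(3) by (simp add: sew_Suc_left, blast)
qed

lemma sewn_descend_right:
  assumes "a \<le> u" "u \<le> v" "(u + v) / 2 \<le> t" "t \<le> v" "v \<le> b"
  shows "sewn u v t = sewn u ((u + v) / 2) ((u + v) / 2) + sewn ((u + v) / 2) v t"
proof -
  let ?m = "(u + v) / 2"
  have 1: "(\<lambda>n. sew Xi (Suc n) u v t) \<longlonglongrightarrow> sewn u v t"
    using assms by (intro LIMSEQ_Suc sewn_limit(1)) auto
  have 2: "(\<lambda>n. sew Xi n u ?m ?m + sew Xi n ?m v t) \<longlonglongrightarrow> sewn u ?m ?m + sewn ?m v t"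
    using assms by (intro tendsto_add sewn_limit(1)) auto
  have "sew Xi (Suc n) u v t = sew Xi n u ?m ?m + sew Xi n ?m v t" for n
  proof (cases "t = ?m")
    case True
    have "sew Xi n ?m v ?m = 0" using assms by (intro sew_left) auto
    then show ?thesis unfolding True by (simp only: sew_Suc_left[OF order_refl] add_0_right)
  qed (use assms in \<open>simp add: sew_Suc_right\<close>)
  then show ?thesis using 1 2 LIMSEQ_unique by simp
qed

text \<open>The series only controls the error by the length of the ambient interval. If \<open>t\<close> lies close to \<open>u\<close>,
that is too weak; but then the bisection of \<open>{u..v}\<close> below \<open>t\<close> is the bisection of its left half, so one may
shrink the interval until \<open>t\<close> is in the right half and \<open>v - u \<le> 2 * (t - u)\<close>.\<close>

lemma sewn_from_left:
  assumes "a \<le> u" "u < t" "t \<le> v" "v \<le> b"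
  shows "norm (sewn u v t - Xi u t) \<le> 2 powr \<theta> * K0 * (t - u) powr \<theta>"
proof -
  obtain k where "(v - u) / (t - u) < 2 ^ k" using real_arch_pow[of 2] by auto
  then have "v - u \<le> 2 ^ k * (t - u)" using assms by (simp add: field_simps)
  then show ?thesis using assms
  proof (induction k arbitrary: v)
    case 0
    then have "v = t" by auto
    moreover have "K0 * (t - u) powr \<theta> * 1 \<le> K0 * (t - u) powr \<theta> * 2 powr \<theta>"
      using \<theta> by (intro mult_left_mono mult_nonneg_nonneg K0) (auto intro: ge_one_powr_ge_zero)
    ultimately show ?case using sewn_limit(2)[of u t v] 0 by (simp add: mult_ac)
  next
    case (Suc k)
    show ?case
    proof (cases "t \<le> (u + v) / 2")
      case True
      then show ?thesis using Suc.IH[of "(u + v) / 2"] Suc.prems sewn_descend_left[of u t v]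
        by (auto simp: field_simps)
    next
      case False
      have "(v - u) powr \<theta> \<le> (2 * (t - u)) powr \<theta>" using False Suc.prems \<theta>
        by (intro powr_mono2) auto
      also have "\<dots> = 2 powr \<theta> * (t - u) powr \<theta>" by (rule powr_mult)
      finally have "K0 * (v - u) powr \<theta> \<le> K0 * (2 powr \<theta> * (t - u) powr \<theta>)"
        using K0 by (intro mult_left_mono) auto
      then show ?thesis using sewn_limit(2)[of u t v] Suc.prems by (simp add: mult_ac)
    qed
  qed
qed

lemma sewn_from_right:
  assumes "a \<le> u" "u \<le> s" "s < v" "v \<le> b"
  shows "norm (sewn u v v - sewn u v s - Xi s v) \<le> 2 powr \<theta> * (2 * K0 + c) * (v - s) powr \<theta>"
proof -
  obtain k where "(v - u) / (v - s) < 2 ^ k" using real_arch_pow[of 2] by auto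
  then have "v - u \<le> 2 ^ k * (v - s)" using assms by (simp add: field_simps)
  then show ?thesis using assms
  proof (induction k arbitrary: u)
    case 0
    then have "u = s" by auto
    have le: "K0 * (v - s) powr \<theta> * 1 \<le> (2 * K0 + c) * (v - s) powr \<theta> * 2 powr \<theta>"
      using K0 \<theta> c by (intro mult_mono mult_right_mono) (auto intro: ge_one_powr_ge_zero)
    have "sewn s v s = 0" using sewn_limit(1)[of s s v] 0 sew_left[of s v] \<open>u = s\<close>
      by (simp add: LIMSEQ_const_iff)
    then show ?case using sewn_limit(2)[of s v v] 0 \<open>u = s\<close> le by (simp add: mult_ac)
  next
    case (Suc k)
    let ?m = "(u + v) / 2"
    show ?case
    proof (cases "?m \<le> s")
      case True
      have "sewn u v v - sewn u v s = sewn ?m v v - sewn ?m v s"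
        using sewn_descend_right[of u v v] sewn_descend_right[of u v s] Suc.prems True by simp
      moreover have "v - ?m \<le> 2 ^ k * (v - s)" using Suc.prems by (simp add: field_simps)
      then have "norm (sewn ?m v v - sewn ?m v s - Xi s v) \<le> 2 powr \<theta> * (2 * K0 + c) * (v - s) powr \<theta>"
        using Suc.prems True by (intro Suc.IH) auto
      ultimately show ?thesis by simp
    next
      case False
      have "sewn u v v - sewn u v s - Xi s v =
        (sewn u v v - Xi u v) - (sewn u v s - Xi u s) + (Xi u v - Xi u s - Xi s v)" by simp
      also have "norm \<dots> \<le> K0 * (v - u) powr \<theta> + K0 * (v - u) powr \<theta> + c * (v - u) powr \<theta>"
        using Suc.prems
        by (intro norm_triangle_mono norm_triangle_le_diff add_mono sewn_limit(2) defect) auto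
      also have "\<dots> = (2 * K0 + c) * (v - u) powr \<theta>" by (simp add: algebra_simps)
      also have "\<dots> \<le> (2 * K0 + c) * (2 * (v - s)) powr \<theta>" using False Suc.prems \<theta> K0 c
        by (intro powr_mono2 mult_left_mono) auto
      also have "\<dots> = (2 * K0 + c) * (2 powr \<theta> * (v - s) powr \<theta>)"
        using Suc.prems by (subst powr_mult) auto
      finally show ?thesis by (simp add: mult_ac)
    qed
  qed
qed

text \<open>For two interior points, shrink the dyadic interval until its midpoint separates them; the increment
then consists of a piece ending at the midpoint and a piece starting there, which are the two
one-sided cases.\<close>

lemma sewn_increment:
  assumes "a \<le> u" "u \<le> s" "s < t" "t \<le> v" "v \<le> b"
  shows "norm (sewn u v t - sewn u v s - Xi s t) \<le> sewing_const \<theta> * c * (t - s) powr \<theta>"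
proof -
  obtain k where "(v - u) / (t - s) < 2 ^ k" using real_arch_pow[of 2] by auto
  then have "v - u \<le> 2 ^ k * (t - s)" using assms by (simp add: field_simps)
  then show ?thesis using assms
  proof (induction k arbitrary: u v)
    case 0
    then have "u = s" "v = t" by auto
    have "sewing_const \<theta> * c = 2 powr \<theta> * (2 * K0 + c) + (2 powr \<theta> * K0 + c)"
      by (simp add: sewing_const_def algebra_simps)
    moreover have "0 \<le> 2 powr \<theta> * K0 + c"
      by (intro add_nonneg_nonneg mult_nonneg_nonneg K0 c) auto
    ultimately have "2 powr \<theta> * (2 * K0 + c) \<le> sewing_const \<theta> * c" by linarith
    then have "2 powr \<theta> * (2 * K0 + c) * (t - s) powr \<theta> \<le> sewing_const \<theta> * c * (t - s) powr \<theta>"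
      by (rule mult_right_mono) auto
    moreover have "norm (sewn u v v - sewn u v s - Xi s v) \<le> 2 powr \<theta> * (2 * K0 + c) * (v - s) powr \<theta>"
      using 0 by (intro sewn_from_right) auto
    ultimately show ?case unfolding \<open>v = t\<close> by linarith
  next
    case (Suc k)
    let ?m = "(u + v) / 2"
    consider "t \<le> ?m" | "?m \<le> s" | "s < ?m" "?m < t" by linarith
    then show ?case
    proof cases
      case 1
      then show ?thesis using Suc.IH[of ?m u] Suc.prems sewn_descend_left[of u t v]
          sewn_descend_left[of u s v] by (auto simp: field_simps)
    next
      case 2
      then show ?thesis using Suc.IH[of v ?m] Suc.prems sewn_descend_right[of u v t]
          sewn_descend_right[of u v s] by (auto simp: field_simps)
    next
      case 3
      let ?d = "(t - s) powr \<theta>"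
      have "sewn u v t - sewn u v s - Xi s t = (sewn u ?m ?m - sewn u ?m s - Xi s ?m)
          + (sewn ?m v t - Xi ?m t) - (Xi s t - Xi s ?m - Xi ?m t)"
        using sewn_descend_right[of u v t] sewn_descend_left[of u s v] Suc.prems 3 by simp
      also have "norm \<dots> \<le> 2 powr \<theta> * (2 * K0 + c) * (?m - s) powr \<theta>
          + 2 powr \<theta> * K0 * (t - ?m) powr \<theta> + c * ?d"
        using Suc.prems 3
        by (intro norm_triangle_mono norm_triangle_le_diff add_mono sewn_from_left
            sewn_from_right defect) auto
      also have "\<dots> \<le> 2 powr \<theta> * (2 * K0 + c) * ?d + 2 powr \<theta> * K0 * ?d + c * ?d"
        using Suc.prems 3 c \<theta>
        by (intro add_mono mult_left_mono powr_mono2 mult_nonneg_nonneg add_nonneg_nonneg K0) auto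
      also have "\<dots> = sewing_const \<theta> * c * ?d"
        by (simp add: sewing_const_def algebra_simps)
      finally show ?thesis .
    qed
  qed
qed

end

text \<open>Known as the sewing lemma. The limit of the bisections of the whole interval \<open>{a..b}\<close> serves as \<open>J\<close>.\<close>

lemma sewing:
  fixes Xi :: "real \<Rightarrow> real \<Rightarrow> 'a::banach"
  assumes "1 < \<theta>" "0 \<le> c"
    and "\<And>u w v. \<lbrakk>a \<le> u; u \<le> w; w \<le> v; v \<le> b\<rbrakk> \<Longrightarrow>
      norm (Xi u v - Xi u w - Xi w v) \<le> c * (v - u) powr \<theta>"
  obtains J where "\<And>s t. \<lbrakk>a \<le> s; s \<le> t; t \<le> b\<rbrakk> \<Longrightarrow>
      norm (J t - J s - Xi s t) \<le> sewing_const \<theta> * c * (t - s) powr \<theta>"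
proof -
  interpret almost_additive Xi a b c \<theta> by unfold_locales (use assms in auto)
  have "norm (sewn a b t - sewn a b s - Xi s t) \<le> sewing_const \<theta> * c * (t - s) powr \<theta>"
    if "a \<le> s" "s \<le> t" "t \<le> b" for s t
    using that sewn_increment[of a s t b] Xi_diag[of s] by (cases "s = t") auto
  then show thesis by (rule that)
qed

section \<open>Young integrals of Hoelder paths\<close>

text \<open>Unlike in \<open>holder_on\<close>, the constant is explicit: everything hinges on constants that are uniform in the
parameter of the equation.\<close>

definition holder_with :: "real \<Rightarrow> real \<Rightarrow> real \<Rightarrow> (real \<Rightarrow> 'b::metric_space) \<Rightarrow> bool" where
  "holder_with C \<alpha> T f \<longleftrightarrow> (\<forall>s\<in>{0..T}. \<forall>t\<in>{0..T}. dist (f s) (f t) \<le> C * \<bar>s - t\<bar> powr \<alpha>)"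

lemma holder_withD:
  fixes f :: "real \<Rightarrow> 'b::real_normed_vector"
  assumes "holder_with C \<alpha> T f" "0 \<le> s" "s \<le> t" "t \<le> T"
  shows "norm (f t - f s) \<le> C * (t - s) powr \<alpha>"
proof -
  have "dist (f s) (f t) \<le> C * \<bar>s - t\<bar> powr \<alpha>" using assms
    unfolding holder_with_def by (meson atLeastAtMost_iff order_trans)
  then show ?thesis using assms(3) by (simp add: dist_norm norm_minus_commute abs_minus_commute)
qed

lemma holder_withI:
  fixes f :: "real \<Rightarrow> 'b::real_normed_vector"
  assumes "\<And>s t. \<lbrakk>0 \<le> s; s \<le> t; t \<le> T\<rbrakk> \<Longrightarrow> norm (f t - f s) \<le> C * (t - s) powr \<alpha>"
  shows "holder_with C \<alpha> T f"
  unfolding holder_with_def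
proof (intro ballI)
  fix s t assume "s \<in> {0..T}" "t \<in> {0..T}"
  then show "dist (f s) (f t) \<le> C * \<bar>s - t\<bar> powr \<alpha>"
    using assms[of s t] assms[of t s] by (cases "s \<le> t") (auto simp: dist_norm norm_minus_commute abs_minus_commute)
qed

lemma holder_with_mono: "holder_with C \<alpha> T f \<Longrightarrow> C \<le> D \<Longrightarrow> holder_with D \<alpha> T f"
  unfolding holder_with_def by (meson mult_right_mono order_trans powr_ge_zero)

definition riemann_sum :: "(real \<Rightarrow> 'b::real_normed_vector) \<Rightarrow> (real \<Rightarrow> real) \<Rightarrow> real \<Rightarrow> nat \<Rightarrow> 'b" where
  "riemann_sum f g t N = (\<Sum>i<N. (g (t * real (Suc i) / real N) - g (t * real i / real N)) *\<^sub>R f (t * real i / real N))"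

text \<open>Increments of \<open>J\<close> telescope over every tagged division, so the difference between a Riemann--Stieltjes
sum and \<open>J t - J 0\<close> is a sum of local errors; these are superlinear in the length and hence small
with the mesh. No two divisions have to be compared.\<close>

lemma has_RS_integral_of_local_estimate:
  fixes f J :: "real \<Rightarrow> 'b::real_normed_vector"
  assumes "1 < \<theta>" "0 \<le> D" "0 \<le> t"
    and est: "\<And>u x v. \<lbrakk>0 \<le> u; u \<le> x; x \<le> v; v \<le> t\<rbrakk> \<Longrightarrow>
      norm (J v - J u - (g v - g u) *\<^sub>R f x) \<le> D * (v - u) powr \<theta>"
  shows "has_RS_integral f g 0 t (J t - J 0)"
  unfolding has_RS_integral_def
proof (intro allI impI)
  fix e :: real assume e: "0 < e"
  \<comment> \<open>The mesh for which the total error \<open>D * \<delta> powr (\<theta> - 1) * t\<close> is below \<open>e\<close>.\<close>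
  define \<delta> where "\<delta> = (e / (D * t + 1)) powr (1 / (\<theta> - 1))"
  have Dt: "0 \<le> D * t" using assms by simp
  then have \<delta>: "0 < \<delta>" using e by (simp add: \<delta>_def)
  have \<delta>_pow: "\<delta> powr (\<theta> - 1) = e / (D * t + 1)"
    using Dt e assms(1) by (simp add: \<delta>_def powr_powr)
  have small: "D * \<delta> powr (\<theta> - 1) * t < e"
    unfolding \<delta>_pow using Dt e by (simp add: field_simps)
  show "\<exists>\<delta>>0. \<forall>p. p tagged_division_of {0..t} \<and> (\<forall>(x, K)\<in>p. diameter K < \<delta>) \<longrightarrow>
      norm ((\<Sum>(x, K)\<in>p. (g (Sup K) - g (Inf K)) *\<^sub>R f x) - (J t - J 0)) < e"
  proof (intro exI[of _ \<delta>] conjI allI impI \<delta>; elim conjE)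
    fix p :: "(real \<times> real set) set"
    assume p: "p tagged_division_of {0..t}" and fine: "\<forall>(x, K)\<in>p. diameter K < \<delta>"
    have "norm ((\<Sum>(x, K)\<in>p. (g (Sup K) - g (Inf K)) *\<^sub>R f x) - (\<Sum>(x, K)\<in>p. J (Sup K) - J (Inf K)))
       = norm (\<Sum>(x, K)\<in>p. J (Sup K) - J (Inf K) - (g (Sup K) - g (Inf K)) *\<^sub>R f x)"
      by (simp add: case_prod_beta sum_subtractf norm_minus_commute)
    also have "\<dots> \<le> (\<Sum>(x, K)\<in>p. D * \<delta> powr (\<theta> - 1) * (Sup K - Inf K))"
    proof (rule sum_norm_le, clarify)
      fix x K assume xK: "(x, K) \<in> p"
      obtain u v where K: "K = {u..v}" using tagged_division_ofD(4)[OF p xK] by (auto simp: box_real)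
      have x: "u \<le> x" "x \<le> v" using tagged_division_ofD(2)[OF p xK] K by auto
      have sub: "0 \<le> u" "v \<le> t" using tagged_division_ofD(3)[OF p xK] K x by auto
      have "v - u < \<delta>" using fine xK K x by (auto simp: diameter_closed_interval)
      then have "(v - u) * (v - u) powr (\<theta> - 1) \<le> (v - u) * \<delta> powr (\<theta> - 1)"
        using x assms(1) by (intro mult_left_mono powr_mono2) auto
      moreover have "(v - u) * (v - u) powr (\<theta> - 1) = (v - u) powr \<theta>"
        using x by (cases "u = v") (auto simp: powr_mult_base)
      ultimately have "D * (v - u) powr \<theta> \<le> D * ((v - u) * \<delta> powr (\<theta> - 1))"
        using assms(2) by (intro mult_left_mono) auto
      then show "norm (J (Sup K) - J (Inf K) - (g (Sup K) - g (Inf K)) *\<^sub>R f x) \<le> D * \<delta> powr (\<theta> - 1) * (Sup K - Inf K)"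
        using est[of u x v] x sub K by (simp add: mult_ac)
    qed
    also have "\<dots> = D * \<delta> powr (\<theta> - 1) * (\<Sum>(x, K)\<in>p. Sup K - Inf K)"
      by (simp add: sum_distrib_left case_prod_beta)
    also have "\<dots> = D * \<delta> powr (\<theta> - 1) * t"
      using additive_tagged_division_1[OF assms(3) p, of "\<lambda>x. x"] by simp
    also note small
    also have "(\<Sum>(x, K)\<in>p. J (Sup K) - J (Inf K)) = J t - J 0"
      by (rule additive_tagged_division_1[OF assms(3) p])
    finally show "norm ((\<Sum>(x, K)\<in>p. (g (Sup K) - g (Inf K)) *\<^sub>R f x) - (J t - J 0)) < e" .
  qed
qed

text \<open>Young integration as a case of sewing: the defect of \<open>Xi u v = (g v - g u) *\<^sub>R f u\<close> is the product
\<open>(g v - g w) *\<^sub>R (f w - f u)\<close> of two increments, which has order \<open>2 * \<alpha> > 1\<close>.\<close>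

lemma young_primitive:
  fixes f :: "real \<Rightarrow> 'b::banach"
  assumes \<alpha>: "1 / 2 < \<alpha>" and C: "0 \<le> C" "0 \<le> G"
    and f: "holder_with C \<alpha> T f" and g: "holder_with G \<alpha> T g"
  obtains J where
    "\<And>s t. \<lbrakk>0 \<le> s; s \<le> t; t \<le> T\<rbrakk> \<Longrightarrow>
      norm (J t - J s - (g t - g s) *\<^sub>R f s) \<le> sewing_const (2 * \<alpha>) * (C * G) * (t - s) powr (2 * \<alpha>)"
    and "\<And>t. \<lbrakk>0 \<le> t; t \<le> T\<rbrakk> \<Longrightarrow> has_RS_integral f g 0 t (J t - J 0)"
proof -
  have prod_bound: "norm ((g v - g w) *\<^sub>R (f x - f u)) \<le> C * G * (v - u) powr (2 * \<alpha>)"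
    if "0 \<le> u" "u \<le> x" "x \<le> v" "u \<le> w" "w \<le> v" "v \<le> T" for u w x v
  proof -
    have "norm ((g v - g w) *\<^sub>R (f x - f u)) = \<bar>g v - g w\<bar> * norm (f x - f u)" by simp
    also have "\<dots> \<le> (G * (v - w) powr \<alpha>) * (C * (x - u) powr \<alpha>)"
      using that holder_withD[OF f, of u x] holder_withD[OF g, of w v] C by (intro mult_mono) auto
    also have "\<dots> \<le> (G * (v - u) powr \<alpha>) * (C * (v - u) powr \<alpha>)"
      using that C \<alpha> by (intro mult_mono powr_mono2) auto
    also have "\<dots> = C * G * (v - u) powr (2 * \<alpha>)"
      using powr_add[of "v - u" \<alpha> \<alpha>] by simp
    finally show ?thesis .
  qed
  have defect: "norm ((g v - g u) *\<^sub>R f u - (g w - g u) *\<^sub>R f u - (g v - g w) *\<^sub>R f w) \<le> C * G * (v - u) powr (2 * \<alpha>)"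
    if "0 \<le> u" "u \<le> w" "w \<le> v" "v \<le> T" for u w v
  proof -
    have "(g v - g u) *\<^sub>R f u - (g w - g u) *\<^sub>R f u - (g v - g w) *\<^sub>R f w = - ((g v - g w) *\<^sub>R (f w - f u))"
      by (simp add: algebra_simps)
    then show ?thesis using prod_bound[of u w v w] that by (simp only: norm_minus_cancel)
  qed
  have "1 < 2 * \<alpha>" "0 \<le> C * G" using \<alpha> C by auto
  from sewing[where Xi = "\<lambda>u v. (g v - g u) *\<^sub>R f u", OF this defect]
  obtain J where J: "\<And>s t. \<lbrakk>0 \<le> s; s \<le> t; t \<le> T\<rbrakk> \<Longrightarrow>
      norm (J t - J s - (g t - g s) *\<^sub>R f s) \<le> sewing_const (2 * \<alpha>) * (C * G) * (t - s) powr (2 * \<alpha>)" by blast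
  have "has_RS_integral f g 0 t (J t - J 0)" if t: "0 \<le> t" "t \<le> T" for t
  proof (rule has_RS_integral_of_local_estimate)
    show "1 < 2 * \<alpha>" using \<alpha> by simp
    show "0 \<le> sewing_const (2 * \<alpha>) * (C * G) + C * G"
      using sewing_const_nonneg[of "2 * \<alpha>"] \<alpha> C by simp
    fix u x v assume "0 \<le> u" "u \<le> x" "x \<le> v" "v \<le> t"
    then show "norm (J v - J u - (g v - g u) *\<^sub>R f x) \<le>
      (sewing_const (2 * \<alpha>) * (C * G) + C * G) * (v - u) powr (2 * \<alpha>)"
      using norm_triangle_ineq4[of "J v - J u - (g v - g u) *\<^sub>R f u" "(g v - g u) *\<^sub>R (f x - f u)"]
        J[of u v] prod_bound[of u x v u] t by (simp add: algebra_simps)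
  qed (use t in auto)
  with J show thesis by (rule that)
qed

text \<open>The error bounds depend on \<open>f\<close> and \<open>g\<close> only through their Hoelder constants.\<close>

lemma young_integral:
  fixes f :: "real \<Rightarrow> 'b::banach"
  assumes \<alpha>: "1 / 2 < \<alpha>" and C: "0 \<le> C" "0 \<le> G"
    and f: "holder_with C \<alpha> T f" and g: "holder_with G \<alpha> T g"
  shows young_integrable: "\<And>t. \<lbrakk>0 \<le> t; t \<le> T\<rbrakk> \<Longrightarrow> has_RS_integral f g 0 t (RS_integral f g 0 t)"
    and young_increment: "\<And>s t. \<lbrakk>0 \<le> s; s \<le> t; t \<le> T\<rbrakk> \<Longrightarrow>
      norm (RS_integral f g 0 t - RS_integral f g 0 s - (g t - g s) *\<^sub>R f s)
        \<le> sewing_const (2 * \<alpha>) * (C * G) * (t - s) powr (2 * \<alpha>)"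
    and young_riemann_sum: "\<And>t N. \<lbrakk>0 \<le> t; t \<le> T; 0 < N\<rbrakk> \<Longrightarrow>
      norm (RS_integral f g 0 t - riemann_sum f g t N)
        \<le> sewing_const (2 * \<alpha>) * (C * G) * t powr (2 * \<alpha>) * real N powr (1 - 2 * \<alpha>)"
proof -
  obtain J where J: "\<And>s t. \<lbrakk>0 \<le> s; s \<le> t; t \<le> T\<rbrakk> \<Longrightarrow>
      norm (J t - J s - (g t - g s) *\<^sub>R f s) \<le> sewing_const (2 * \<alpha>) * (C * G) * (t - s) powr (2 * \<alpha>)"
    and RS: "\<And>t. \<lbrakk>0 \<le> t; t \<le> T\<rbrakk> \<Longrightarrow> has_RS_integral f g 0 t (J t - J 0)"
    using young_primitive[OF assms] by metis
  have eq: "RS_integral f g 0 t = J t - J 0" if "0 \<le> t" "t \<le> T" for t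
    using RS_integral_eqI[OF RS[OF that]] .
  show "has_RS_integral f g 0 t (RS_integral f g 0 t)" if "0 \<le> t" "t \<le> T" for t
    using RS[OF that] eq[OF that] by simp
  show "norm (RS_integral f g 0 t - RS_integral f g 0 s - (g t - g s) *\<^sub>R f s)
        \<le> sewing_const (2 * \<alpha>) * (C * G) * (t - s) powr (2 * \<alpha>)"
    if "0 \<le> s" "s \<le> t" "t \<le> T" for s t
    using J[OF that] that by (simp add: eq)
  show "norm (RS_integral f g 0 t - riemann_sum f g t N)
        \<le> sewing_const (2 * \<alpha>) * (C * G) * t powr (2 * \<alpha>) * real N powr (1 - 2 * \<alpha>)"
    if t: "0 \<le> t" "t \<le> T" and N: "0 < N" for t N
  proof -
    let ?p = "\<lambda>i. t * real i / real N"
    let ?K = "sewing_const (2 * \<alpha>) * (C * G)"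
    have p: "0 \<le> ?p i" "?p i \<le> ?p (Suc i)" "?p (Suc i) \<le> T" "?p (Suc i) - ?p i = t / real N" if "i < N" for i
    proof -
      have "t * real (Suc i) \<le> t * real N" using that t by (intro mult_left_mono) auto
      then show "?p (Suc i) \<le> T" using N t by (simp add: field_simps)
        (metis mult.commute mult_left_mono of_nat_0_le_iff order_trans)
    qed (use t N in \<open>auto simp: field_simps\<close>)
    have "J t - J 0 = (\<Sum>i<N. J (?p (Suc i)) - J (?p i))"
      using sum_lessThan_telescope[of "\<lambda>i. J (?p i)" N] N by simp
    then have "norm (RS_integral f g 0 t - riemann_sum f g t N) =
       norm (\<Sum>i<N. J (?p (Suc i)) - J (?p i) - (g (?p (Suc i)) - g (?p i)) *\<^sub>R f (?p i))"
      using t by (simp add: eq riemann_sum_def sum_subtractf)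
    also have "\<dots> \<le> (\<Sum>i<N. ?K * (t / real N) powr (2 * \<alpha>))"
      using J[OF p(1,2,3)] p(4) by (intro sum_norm_le) (simp only: lessThan_iff)
    also have "\<dots> = ?K * (t powr (2 * \<alpha>) / real N powr (2 * \<alpha>)) * real N"
      using t by (simp add: powr_divide)
    also have "\<dots> = ?K * t powr (2 * \<alpha>) * real N powr (1 - 2 * \<alpha>)"
      using N by (simp add: powr_diff)
    finally show ?thesis .
  qed
qed

lemma riemann_sum_error_tendsto: 
  assumes "1 / 2 < \<alpha>" shows "(\<lambda>N. c * real N powr (1 - 2 * \<alpha>)) \<longlonglongrightarrow> 0"
proof -
  have "(\<lambda>N. real N powr (1 - 2 * \<alpha>)) \<longlonglongrightarrow> 0"
    using assms by (intro tendsto_neg_powr filterlim_real_sequentially) auto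
  from tendsto_mult_left[OF this, of c] show ?thesis by simp
qed

lemma riemann_sum_tendsto:
  fixes f :: "real \<Rightarrow> 'b::banach"
  assumes "1 / 2 < \<alpha>" "0 \<le> C" "0 \<le> G" "holder_with C \<alpha> T f" "holder_with G \<alpha> T g" "0 \<le> t" "t \<le> T"
  shows "riemann_sum f g t \<longlonglongrightarrow> RS_integral f g 0 t"
proof -
  have "(\<lambda>N. RS_integral f g 0 t - riemann_sum f g t N) \<longlonglongrightarrow> 0"
  proof (rule Lim_null_comparison[OF _ riemann_sum_error_tendsto[OF assms(1)]])
    show "\<forall>\<^sub>F N in sequentially. norm (RS_integral f g 0 t - riemann_sum f g t N)
      \<le> sewing_const (2 * \<alpha>) * (C * G) * t powr (2 * \<alpha>) * real N powr (1 - 2 * \<alpha>)"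
      using eventually_gt_at_top[of 0] by eventually_elim (rule young_riemann_sum[OF assms])
  qed
  from tendsto_diff[OF tendsto_const[of "RS_integral f g 0 t"] this] show ?thesis by simp
qed

text \<open>Riemann sums over a fixed grid are continuous in the integrand, and they approximate the integral
uniformly over integrands with a common Hoelder constant. So pointwise convergence of the integrands
suffices.\<close>

lemma RS_integral_limit:
  fixes f :: "real \<Rightarrow> 'b::banach"
  assumes \<alpha>: "1 / 2 < \<alpha>" and C: "0 \<le> C" "0 \<le> G" and g: "holder_with G \<alpha> T g"
    and fk: "\<And>k. holder_with C \<alpha> T (fk k)" and f: "holder_with C \<alpha> T f"
    and lim: "\<And>s. \<lbrakk>0 \<le> s; s \<le> T\<rbrakk> \<Longrightarrow> (\<lambda>k. fk k s) \<longlonglongrightarrow> f s"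
    and t: "0 \<le> t" "t \<le> T"
  shows "(\<lambda>k::nat. RS_integral (fk k) g 0 t) \<longlonglongrightarrow> RS_integral f g 0 t"
proof (rule LIMSEQ_I)
  fix e :: real assume e: "0 < e"
  let ?E = "\<lambda>N. sewing_const (2 * \<alpha>) * (C * G) * t powr (2 * \<alpha>) * real N powr (1 - 2 * \<alpha>)"
  have "\<forall>\<^sub>F N in sequentially. ?E N < e / 3 \<and> 0 < N"
    using order_tendstoD(2)[OF riemann_sum_error_tendsto[OF \<alpha>], of "e / 3"] e
    by (intro eventually_conj eventually_gt_at_top) auto
  then obtain N where N: "?E N < e / 3" "0 < N" by (auto simp: eventually_sequentially)
  have "0 \<le> t * real i / real N \<and> t * real i / real N \<le> T" if "i < N" for i
  proof -
    have "t * real i \<le> t * real N" using that t by (intro mult_left_mono) auto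
    also have "\<dots> \<le> T * real N" using t by (intro mult_right_mono) auto
    finally show ?thesis using N t by (simp add: field_simps)
  qed
  then have "(\<lambda>k. riemann_sum (fk k) g t N) \<longlonglongrightarrow> riemann_sum f g t N"
    unfolding riemann_sum_def by (intro tendsto_sum tendsto_scaleR tendsto_const lim) auto
  then obtain k0 where k0: "\<And>k. k0 \<le> k \<Longrightarrow> norm (riemann_sum (fk k) g t N - riemann_sum f g t N) < e / 3"
    using LIMSEQ_D[of _ _ "e / 3"] e by fastforce
  have "norm (RS_integral (fk k) g 0 t - RS_integral f g 0 t) < e" if "k0 \<le> k" for k
  proof -
    have "norm (RS_integral (fk k) g 0 t - riemann_sum (fk k) g t N) < e / 3"
      using young_riemann_sum[OF \<alpha> C fk g t N(2), of k] N(1) by linarith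
    moreover have "norm (RS_integral f g 0 t - riemann_sum f g t N) < e / 3"
      using young_riemann_sum[OF \<alpha> C f g t N(2)] N(1) by linarith
    ultimately show ?thesis using k0[OF that]
      norm_triangle_ineq[of "RS_integral (fk k) g 0 t - riemann_sum (fk k) g t N" "riemann_sum (fk k) g t N - riemann_sum f g t N"]
      norm_triangle_ineq4[of "RS_integral (fk k) g 0 t - riemann_sum f g t N" "RS_integral f g 0 t - riemann_sum f g t N"]
      by simp
  qed
  then show "\<exists>k0. \<forall>k\<ge>k0. norm (RS_integral (fk k) g 0 t - RS_integral f g 0 t) < e" by blast
qed

text \<open>This makes the drift term one more Young integral, with the identity as integrator.\<close>

lemma has_RS_integral_identity:
  fixes f :: "real \<Rightarrow> 'b::real_normed_vector"
  assumes "has_RS_integral f (\<lambda>s. s) 0 t I"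
  shows "(f has_integral I) {0..t}"
  unfolding has_integral_real
proof (intro allI impI)
  fix e :: real assume "0 < e"
  then obtain \<delta> where \<delta>: "0 < \<delta>" "\<And>p. p tagged_division_of {0..t} \<Longrightarrow> (\<forall>(x, K)\<in>p. diameter K < \<delta>) \<Longrightarrow>
        norm ((\<Sum>(x, K)\<in>p. (Sup K - Inf K) *\<^sub>R f x) - I) < e"
    using assms unfolding has_RS_integral_def by meson
  show "\<exists>\<gamma>. gauge \<gamma> \<and> (\<forall>p. p tagged_division_of {0..t} \<and> \<gamma> fine p \<longrightarrow>
      norm ((\<Sum>(x, K)\<in>p. measure lborel K *\<^sub>R f x) - I) < e)"
  proof (intro exI conjI allI impI; (elim conjE)?)
    show "gauge (\<lambda>x::real. ball x (\<delta> / 3))" using \<delta>(1) by (intro gauge_ball) auto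
    fix p assume p: "p tagged_division_of {0..t}" and fine: "(\<lambda>x. ball x (\<delta> / 3)) fine p"
    have "diameter K < \<delta>" if "(x, K) \<in> p" for x K
    proof -
      have "K \<subseteq> ball x (\<delta> / 3)" using fine that by (auto simp: fine_def)
      then have "diameter K \<le> diameter (ball x (\<delta> / 3))" by (intro diameter_subset) auto
      then show ?thesis using \<delta>(1) by simp
    qed
    moreover have "measure lborel K = Sup K - Inf K" if xK: "(x, K) \<in> p" for x K
    proof -
      obtain u v where K: "K = {u..v}" using tagged_division_ofD(4)[OF p xK] by (auto simp: box_real)
      moreover have "u \<le> v" using tagged_division_ofD(2)[OF p xK] K by auto
      ultimately show ?thesis by simp
    qed
    then have "(\<Sum>(x, K)\<in>p. measure lborel K *\<^sub>R f x) = (\<Sum>(x, K)\<in>p. (Sup K - Inf K) *\<^sub>R f x)"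
      by (intro sum.cong) auto
    ultimately show "norm ((\<Sum>(x, K)\<in>p. measure lborel K *\<^sub>R f x) - I) < e" using \<delta>(2)[OF p] by auto
  qed
qed

section \<open>A priori bounds for Hoelder solutions\<close>

lemma holder_with_compose:
  assumes "\<And>p q. dist (F p) (F q) \<le> L * dist p q" "0 \<le> L" "holder_with C \<alpha> T x"
  shows "holder_with (L * C) \<alpha> T (\<lambda>s. F (x s))"
  unfolding holder_with_def
proof (intro ballI)
  fix s t assume "s \<in> {0..T}" "t \<in> {0..T}"
  then have "L * dist (x s) (x t) \<le> L * (C * \<bar>s - t\<bar> powr \<alpha>)"
    using assms(2,3) by (intro mult_left_mono) (auto simp: holder_with_def)
  with assms(1)[of "x s" "x t"] show "dist (F (x s)) (F (x t)) \<le> L * C * \<bar>s - t\<bar> powr \<alpha>"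
    by (simp add: mult.assoc)
qed

lemma holder_with_tendsto:
  assumes "\<And>k. holder_with C \<alpha> T (xk k)" "\<And>s. \<lbrakk>0 \<le> s; s \<le> T\<rbrakk> \<Longrightarrow> (\<lambda>k::nat. xk k s) \<longlonglongrightarrow> x s"
  shows "holder_with C \<alpha> T x"
  unfolding holder_with_def
proof (intro ballI)
  fix s t assume "s \<in> {0..T}" "t \<in> {0..T}"
  then have "(\<lambda>k. dist (xk k s) (xk k t)) \<longlonglongrightarrow> dist (x s) (x t)"
    by (intro tendsto_dist assms(2)) auto
  moreover have "dist (xk k s) (xk k t) \<le> C * \<bar>s - t\<bar> powr \<alpha>" for k
    using assms(1)[of k] \<open>s \<in> _\<close> \<open>t \<in> _\<close> by (auto simp: holder_with_def)
  ultimately show "dist (x s) (x t) \<le> C * \<bar>s - t\<bar> powr \<alpha>" by (intro LIMSEQ_le_const2) auto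
qed

text \<open>Cutting \<open>{s..t}\<close> into \<open>N\<close> equal pieces multiplies the first-order term by \<open>N powr (1 - \<alpha>)\<close>, which may be
large, but the second-order term by \<open>N powr (1 - 2 * \<alpha>)\<close>, which tends to zero as \<open>\<alpha> > 1 / 2\<close>.\<close>

lemma increment_subdivision:
  fixes x :: "real \<Rightarrow> 'b::real_normed_vector"
  assumes loc: "\<And>s t. \<lbrakk>0 \<le> s; s \<le> t; t \<le> T\<rbrakk> \<Longrightarrow>
      norm (x t - x s) \<le> (A + K * (t - s) powr \<alpha>) * (t - s) powr \<alpha>"
    and "0 < N" "0 \<le> K" "0 \<le> \<alpha>"
  shows "holder_with (real N powr (1 - \<alpha>) * A + real N powr (1 - 2 * \<alpha>) * K * T powr \<alpha>) \<alpha> T x"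
proof (rule holder_withI)
  fix s t assume st: "0 \<le> s" "s \<le> t" "t \<le> T"
  let ?n = "real N" and ?d = "t - s"
  let ?p = "\<lambda>i. s + ?d * real i / ?n"
  have step: "norm (x (?p (Suc i)) - x (?p i)) \<le> (A + K * (?d / ?n) powr \<alpha>) * (?d / ?n) powr \<alpha>" if "i < N" for i
  proof -
    have eq: "?p (Suc i) - ?p i = ?d / ?n" using assms(2) by (simp add: field_simps)
    have "?d * real (Suc i) \<le> ?d * ?n" using that st by (intro mult_left_mono) auto
    then have "?d * real (Suc i) / ?n \<le> ?d" using assms(2) by (simp add: divide_le_eq)
    then have "?p (Suc i) \<le> T" using st by simp
    moreover have "0 \<le> ?p i" using st by simp
    moreover have "?p i \<le> ?p (Suc i)" using eq st assms(2) by (smt (verit) divide_nonneg_nonneg of_nat_0_le_iff)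
    ultimately show ?thesis using loc[of "?p i" "?p (Suc i)"] unfolding eq by simp
  qed
  have "norm (x t - x s) = norm (\<Sum>i<N. x (?p (Suc i)) - x (?p i))"
    using sum_lessThan_telescope[of "\<lambda>i. x (?p i)" N] assms(2) by simp
  also have "\<dots> \<le> (\<Sum>i<N. (A + K * (?d / ?n) powr \<alpha>) * (?d / ?n) powr \<alpha>)"
    using step by (intro sum_norm_le) (simp only: lessThan_iff)
  also have "\<dots> = (?n powr (1 - \<alpha>) * A + ?n powr (1 - 2 * \<alpha>) * K * ?d powr \<alpha>) * ?d powr \<alpha>"
  proof -
    have n: "?n powr (1 - \<alpha>) = ?n / ?n powr \<alpha>" "?n powr (1 - 2 * \<alpha>) = ?n / (?n powr \<alpha> * ?n powr \<alpha>)"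
      using assms(2) powr_add[of ?n \<alpha> \<alpha>] by (auto simp: powr_diff)
    have alg: "a * ((A + K * (m / q)) * (m / q)) = (a / q * A + a / (q * q) * K * m) * m" if "0 < q" for a q m :: real
      using that by (simp add: field_simps)
    show ?thesis unfolding n powr_divide sum_constant card_lessThan by (rule alg) (use assms(2) in simp)
  qed
  also have "\<dots> \<le> (?n powr (1 - \<alpha>) * A + ?n powr (1 - 2 * \<alpha>) * K * T powr \<alpha>) * ?d powr \<alpha>"
    using st assms(3,4) by (intro mult_right_mono add_left_mono mult_left_mono powr_mono2) auto
  finally show "norm (x t - x s) \<le> (?n powr (1 - \<alpha>) * A + ?n powr (1 - 2 * \<alpha>) * K * T powr \<alpha>) * (t - s) powr \<alpha>" .
qed

text \<open>If a valid Hoelder constant \<open>C\<close> can always be replaced by \<open>A + C / 2\<close>, iteration drives it to the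
fixed point \<open>2 * A\<close>, whatever finite constant one starts from.\<close>

lemma holder_with_absorb:
  assumes "holder_with C \<alpha> T x"
    and improve: "\<And>C. 0 \<le> C \<Longrightarrow> holder_with C \<alpha> T x \<Longrightarrow> holder_with (A + C / 2) \<alpha> T x"
    and "0 \<le> A"
  shows "holder_with (2 * A) \<alpha> T x"
proof -
  define C' where "C' = max C 0"
  have iter: "holder_with (2 * A + C' / 2 ^ k) \<alpha> T x" for k
  proof (induction k)
    case 0
    have "C \<le> 2 * A + C' / 2 ^ 0" using assms(3) by (simp add: C'_def)
    then show ?case using holder_with_mono[OF assms(1)] by blast
  next
    case (Suc k)
    have "holder_with (A + (2 * A + C' / 2 ^ k) / 2) \<alpha> T x"
      using Suc assms(3) by (intro improve) (auto simp: C'_def)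
    then show ?case by (simp add: add_divide_distrib mult.commute[of 2])
  qed
  have "(\<lambda>k. C' * (1 / 2) ^ k) \<longlonglongrightarrow> C' * 0" by (intro tendsto_mult_left LIMSEQ_power_zero) auto
  then have "(\<lambda>k. (2 * A + C' / 2 ^ k) * d) \<longlonglongrightarrow> (2 * A + 0) * d" for d
    by (intro tendsto_mult_right tendsto_add tendsto_const) (simp add: power_one_over)
  then have lim: "(\<lambda>k. (2 * A + C' / 2 ^ k) * d) \<longlonglongrightarrow> 2 * A * d" for d by simp
  show ?thesis unfolding holder_with_def
  proof (intro ballI)
    fix s t assume "s \<in> {0..T}" "t \<in> {0..T}"
    then have "dist (x s) (x t) \<le> (2 * A + C' / 2 ^ k) * \<bar>s - t\<bar> powr \<alpha>" for k
      using iter[of k] by (auto simp: holder_with_def)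
    then show "dist (x s) (x t) \<le> 2 * A * \<bar>s - t\<bar> powr \<alpha>"
      by (intro LIMSEQ_le_const[OF lim]) auto
  qed
qed

definition solves_system ::
  "real \<Rightarrow> 'a \<Rightarrow> ('i \<Rightarrow> real) \<Rightarrow> ('i \<Rightarrow> 'a \<Rightarrow> 'a) \<Rightarrow> ('i \<Rightarrow> real \<Rightarrow> real) \<Rightarrow> (real \<Rightarrow> 'a::real_normed_vector) \<Rightarrow> bool" where
  "solves_system T x0 w F g x \<longleftrightarrow>
     (\<forall>t\<in>{0..T}. x t = x0 + (\<Sum>i\<in>UNIV. w i *\<^sub>R RS_integral (\<lambda>s. F i (x s)) (g i) 0 t))"

text \<open>The bound \<open>D\<close> does not depend on the solution, nor on the weights as long as they are bounded by \<open>W\<close>.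
Because the coefficients are bounded, Young's estimate turns a Hoelder constant \<open>C\<close> of \<open>x\<close> into a local
estimate of the increments of \<open>x\<close> whose first-order term is free of \<open>C\<close>; \<open>C\<close> enters only the
second-order term, and a fine subdivision makes that contribution at most \<open>C / 2\<close>.\<close>

lemma a_priori_holder_bound:
  fixes F :: "'i::finite \<Rightarrow> 'a::banach \<Rightarrow> 'a" and g :: "'i \<Rightarrow> real \<Rightarrow> real"
  assumes \<alpha>: "1 / 2 < \<alpha>"
    and F: "\<And>i p. norm (F i p) \<le> S" "\<And>i p q. dist (F i p) (F i q) \<le> L * dist p q" "0 \<le> L"
    and g: "\<And>i. holder_with G \<alpha> T (g i)" "0 \<le> G" and W: "0 \<le> W"
  shows "\<exists>D\<ge>0. \<forall>w x0 x C. (\<forall>i. \<bar>w i\<bar> \<le> W) \<longrightarrow> holder_with C \<alpha> T x \<longrightarrow>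
    solves_system T x0 w F g x \<longrightarrow> holder_with D \<alpha> T x"
proof -
  let ?n = "real CARD('i)"
  have S: "0 \<le> S" by (rule order_trans[OF norm_ge_zero F(1)])
  define A where "A = ?n * (W * (G * S))"
  define K where "K = ?n * (W * (sewing_const (2 * \<alpha>) * (L * G)))"
  have A: "0 \<le> A" using W g(2) S by (simp add: A_def)
  have K: "0 \<le> K" using W g(2) F(3) sewing_const_nonneg[of "2 * \<alpha>"] \<alpha> by (simp add: K_def)
  \<comment> \<open>A number of pieces for which the second-order term at least halves the Hoelder constant.\<close>
  have "\<forall>\<^sub>F N in sequentially. K * T powr \<alpha> * real N powr (1 - 2 * \<alpha>) < 1 / 2 \<and> 0 < N"
    using order_tendstoD(2)[OF riemann_sum_error_tendsto[OF \<alpha>], of "1 / 2"]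
    by (intro eventually_conj eventually_gt_at_top) auto
  then obtain N where N: "K * T powr \<alpha> * real N powr (1 - 2 * \<alpha>) < 1 / 2" "0 < N"
    by (auto simp: eventually_sequentially)
  have step: "norm (x t - x s) \<le> (A + K * C * (t - s) powr \<alpha>) * (t - s) powr \<alpha>"
    if w: "\<And>i. \<bar>w i\<bar> \<le> W" and x: "holder_with C \<alpha> T x" "0 \<le> C" and sol: "solves_system T x0 w F g x"
      and st: "0 \<le> s" "s \<le> t" "t \<le> T" for w x0 x C s t
  proof -
    let ?I = "\<lambda>i t. RS_integral (\<lambda>s. F i (x s)) (g i) 0 t"
    let ?d = "(t - s) powr \<alpha>"
    have incr: "norm (?I i t - ?I i s) \<le> G * ?d * S + sewing_const (2 * \<alpha>) * (L * C * G) * (?d * ?d)" for i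
    proof -
      have "norm (?I i t - ?I i s - (g i t - g i s) *\<^sub>R F i (x s))
          \<le> sewing_const (2 * \<alpha>) * (L * C * G) * (t - s) powr (2 * \<alpha>)"
        using \<alpha> g F(3) x st by (intro young_increment[OF \<alpha>] holder_with_compose F) auto
      moreover have "norm ((g i t - g i s) *\<^sub>R F i (x s)) \<le> G * ?d * S"
        unfolding norm_scaleR
        using holder_withD[OF g(1) st, of i] F(1) g(2) by (intro mult_mono) auto
      moreover have "(t - s) powr (2 * \<alpha>) = ?d * ?d" using powr_add[of "t - s" \<alpha> \<alpha>] by simp
      ultimately show ?thesis
        using norm_triangle_sub[of "?I i t - ?I i s" "(g i t - g i s) *\<^sub>R F i (x s)"] by simp
    qed
    have eq: "x t - x s = (\<Sum>i\<in>UNIV. w i *\<^sub>R (?I i t - ?I i s))"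
      using sol st by (simp add: solves_system_def scaleR_diff_right sum_subtractf)
    have "norm (x t - x s) \<le> (\<Sum>i\<in>(UNIV::'i set). W * (G * ?d * S + sewing_const (2 * \<alpha>) * (L * C * G) * (?d * ?d)))"
      unfolding eq
    proof (rule sum_norm_le)
      fix i
      show "norm (w i *\<^sub>R (?I i t - ?I i s)) \<le> W * (G * ?d * S + sewing_const (2 * \<alpha>) * (L * C * G) * (?d * ?d))"
        unfolding norm_scaleR using w incr W by (rule mult_mono) auto
    qed
    also have "\<dots> = (A + K * C * ?d) * ?d"
    proof -
      have "n * (W * (G * d * S + c * (L * C * G) * (d * d))) =
        (n * (W * (G * S)) + n * (W * (c * (L * G))) * C * d) * d" for n c d :: real by algebra
      then show ?thesis unfolding A_def K_def sum_constant .
    qed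
    finally show ?thesis .
  qed
  let ?A = "real N powr (1 - \<alpha>) * A"
  have "holder_with (2 * ?A) \<alpha> T x"
    if w: "\<And>i. \<bar>w i\<bar> \<le> W" and x: "holder_with C \<alpha> T x" and sol: "solves_system T x0 w F g x" for w x0 x C
  proof (rule holder_with_absorb[OF x])
    fix C' :: real assume C': "0 \<le> C'" "holder_with C' \<alpha> T x"
    have "holder_with (?A + real N powr (1 - 2 * \<alpha>) * (K * C') * T powr \<alpha>) \<alpha> T x"
      using step[OF w C'(2,1) sol] N(2) K C'(1) \<alpha> by (intro increment_subdivision) auto
    moreover have "(K * T powr \<alpha> * real N powr (1 - 2 * \<alpha>)) * C' \<le> 1 / 2 * C'"
      using N(1) C'(1) by (intro mult_right_mono) auto
    ultimately show "holder_with (?A + C' / 2) \<alpha> T x"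
      by (elim holder_with_mono) (simp add: mult_ac)
  qed (use A in simp)
  then show ?thesis using A by (intro exI[of _ "2 * ?A"]) auto
qed

section \<open>Hoelder regularity of fractional Brownian motion\<close>

text \<open>Let \<open>d n t\<close> be \<open>t\<close> rounded down to the grid of level \<open>n\<close>. Consecutive roundings agree or are neighbours on
the finer grid, so the increments from \<open>d n t\<close> to \<open>t\<close> sum to a geometric series; and two points
at distance at most \<open>1 / 2 ^ n\<close> round to equal or neighbouring points of level \<open>n\<close>. Levels below \<open>n0\<close>
concern only distant points, for which boundedness of the path is enough.\<close>

lemma dyadic_chaining:
  fixes x :: "real \<Rightarrow> real" and n0 :: nat
  assumes \<alpha>: "0 < \<alpha>" and cont: "continuous_on {0..T} x"
    and step: "\<And>n k. \<lbrakk>n0 \<le> n; real (Suc k) \<le> T * 2 ^ n\<rbrakk> \<Longrightarrow>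
      \<bar>x (real (Suc k) / 2 ^ n) - x (real k / 2 ^ n)\<bar> \<le> (2 powr - \<alpha>) ^ n"
  shows "\<exists>C. holder_with C \<alpha> T x"
proof -
  define \<rho> where "\<rho> = 2 powr - \<alpha>"
  have \<rho>: "0 < \<rho>" "\<rho> < 1" using \<alpha> by (auto simp: \<rho>_def powr_less_one)
  define k where "k n t = nat \<lfloor>t * 2 ^ n\<rfloor>" for n :: nat and t :: real
  define d where "d n t = real (k n t) / 2 ^ n" for n t
  have k_le: "real (k n t) \<le> t * 2 ^ n" and k_gt: "t * 2 ^ n < real (k n t) + 1" if "0 \<le> t" for n t
    using that by (auto simp: k_def)
  have d_le: "d n t \<le> t" and d_ge: "t - 1 / 2 ^ n \<le> d n t" and d_nn: "0 \<le> d n t" if "0 \<le> t" for n t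
  proof -
    have "t \<le> (real (k n t) + 1) / 2 ^ n"
      using k_gt[OF that, of n] by (simp add: pos_le_divide_eq)
    then show "t - 1 / 2 ^ n \<le> d n t" by (simp add: d_def add_divide_distrib)
  qed (use k_le[OF that, of n] in \<open>auto simp: d_def divide_le_eq\<close>)
  have refine: "\<bar>x (d (Suc n) t) - x (d n t)\<bar> \<le> \<rho> ^ Suc n" if n: "n0 \<le> n" and t: "0 \<le> t" "t \<le> T" for n t
  proof -
    have "real (k (Suc n) t) \<le> 2 * (t * 2 ^ n)" "2 * (t * 2 ^ n) < real (k (Suc n) t) + 1"
      using k_le[OF t(1), of "Suc n"] k_gt[OF t(1), of "Suc n"] by (auto simp: mult_ac)
    then have "real (k (Suc n) t) < real (2 * k n t + 2)" "real (2 * k n t) < real (k (Suc n) t + 1)"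
      using k_le[OF t(1), of n] k_gt[OF t(1), of n] by auto
    then have "k (Suc n) t = 2 * k n t \<or> k (Suc n) t = Suc (2 * k n t)" by linarith
    then show ?thesis
    proof
      assume "k (Suc n) t = 2 * k n t"
      then have "d (Suc n) t = d n t" by (simp add: d_def)
      then show ?thesis using \<rho> by simp
    next
      assume eq: "k (Suc n) t = Suc (2 * k n t)"
      have "real (Suc (2 * k n t)) \<le> T * 2 ^ Suc n"
        using k_le[OF t(1), of "Suc n"] t(2) unfolding eq
        by (meson mult_right_mono order_trans zero_le_numeral zero_le_power)
      from step[OF _ this] n have "\<bar>x (real (Suc (2 * k n t)) / 2 ^ Suc n) - x (real (2 * k n t) / 2 ^ Suc n)\<bar> \<le> \<rho> ^ Suc n"
        unfolding \<rho>_def by simp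
      moreover have "real (2 * k n t) / 2 ^ Suc n = d n t" by (simp add: d_def)
      ultimately show ?thesis unfolding d_def[of "Suc n"] eq by simp
    qed
  qed
  have tail: "\<bar>x t - x (d n t)\<bar> \<le> \<rho> ^ n / (1 - \<rho>)" if n: "n0 \<le> n" and t: "0 \<le> t" "t \<le> T" for n t
  proof -
    have part: "\<bar>x (d (n + j) t) - x (d n t)\<bar> \<le> (\<rho> ^ n - \<rho> ^ (n + j)) / (1 - \<rho>)" for j
    proof (induction j)
      case (Suc j)
      have "\<rho> ^ Suc (n + j) \<le> \<rho> ^ (n + j)" using \<rho> by (intro power_decreasing) auto
      moreover have "(\<rho> ^ n - \<rho> ^ (n + j)) / (1 - \<rho>) + \<rho> ^ (n + j) = (\<rho> ^ n - \<rho> ^ Suc (n + j)) / (1 - \<rho>)"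
        using \<rho> by (simp add: field_simps)
      ultimately show ?case using Suc refine[of "n + j" t] n t by simp
    qed simp
    have "(\<lambda>j. d (n + j) t) \<longlonglongrightarrow> t"
    proof (rule real_tendsto_sandwich)
      have "(\<lambda>j. t - (1 / 2) ^ (j + n)) \<longlonglongrightarrow> t - 0"
        by (intro tendsto_diff tendsto_const LIMSEQ_ignore_initial_segment LIMSEQ_power_zero) auto
      then show "(\<lambda>j. t - (1 / 2) ^ (j + n)) \<longlonglongrightarrow> t" by simp
    qed (use d_le[OF t(1)] d_ge[OF t(1)] in \<open>auto simp: power_one_over add.commute[of n]\<close>)
    moreover have "d (n + j) t \<in> {0..T}" for j using d_le[OF t(1), of "n + j"] d_nn[OF t(1), of "n + j"] t by auto
    ultimately have "(\<lambda>j. x (d (n + j) t)) \<longlonglongrightarrow> x t"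
      using t by (intro continuous_on_tendsto_compose[OF cont]) auto
    then have "(\<lambda>j. \<bar>x (d (n + j) t) - x (d n t)\<bar>) \<longlonglongrightarrow> \<bar>x t - x (d n t)\<bar>" by (intro tendsto_intros)
    moreover have "\<bar>x (d (n + j) t) - x (d n t)\<bar> \<le> \<rho> ^ n / (1 - \<rho>)" for j
    proof -
      have "(\<rho> ^ n - \<rho> ^ (n + j)) / (1 - \<rho>) \<le> \<rho> ^ n / (1 - \<rho>)"
        using \<rho> by (intro divide_right_mono) auto
      then show ?thesis using part[of j] by linarith
    qed
    ultimately show ?thesis by (intro LIMSEQ_le_const2) auto
  qed
  have near: "\<bar>x t - x s\<bar> \<le> (2 / (1 - \<rho>) + 1) * \<rho> ^ n"
    if n: "n0 \<le> n" and st: "0 \<le> s" "s \<le> t" "t \<le> T" "t - s \<le> 1 / 2 ^ n" for n s t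
  proof -
    have le: "s * 2 ^ n \<le> t * 2 ^ n" "t * 2 ^ n \<le> s * 2 ^ n + 1" using st by (auto simp: field_simps)
    have "real (k n s) < real (k n t + 1)" "real (k n t) < real (k n s + 2)"
      using k_le[of s n] k_gt[of s n] k_le[of t n] k_gt[of t n] le st(1,2) unfolding of_nat_add
      by linarith+
    then have "k n t = k n s \<or> k n t = Suc (k n s)" by linarith
    then have "\<bar>x (d n t) - x (d n s)\<bar> \<le> \<rho> ^ n"
    proof
      assume eq: "k n t = Suc (k n s)"
      have "t * 2 ^ n \<le> T * 2 ^ n" using st by simp
      then have "real (Suc (k n s)) \<le> T * 2 ^ n" using k_le[of t n] st unfolding eq by linarith
      from step[OF n this] show ?thesis unfolding d_def eq \<rho>_def .
    qed (use \<rho> in \<open>simp add: d_def\<close>)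
    moreover have "\<bar>x t - x (d n t)\<bar> \<le> \<rho> ^ n / (1 - \<rho>)" "\<bar>x s - x (d n s)\<bar> \<le> \<rho> ^ n / (1 - \<rho>)"
      using tail[OF n] st by auto
    moreover have "(2 / (1 - \<rho>) + 1) * \<rho> ^ n = \<rho> ^ n / (1 - \<rho>) + \<rho> ^ n / (1 - \<rho>) + \<rho> ^ n"
      by (simp add: algebra_simps)
    ultimately show ?thesis by linarith
  qed
  have "\<exists>Mx. \<forall>t\<in>{0..T}. \<bar>x t\<bar> \<le> Mx"
    using compact_imp_bounded[OF compact_continuous_image[OF cont compact_Icc]] unfolding bounded_iff by auto
  then obtain Mx where Mx: "\<And>t. t \<in> {0..T} \<Longrightarrow> \<bar>x t\<bar> \<le> Mx" by blast
  define C1 where "C1 = (2 / (1 - \<rho>) + 1) * 2 powr \<alpha>"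
  define C2 where "C2 = 2 * Mx * (2 ^ n0) powr \<alpha>"
  have "holder_with (max C1 C2) \<alpha> T x"
  proof (rule holder_withI)
    fix s t assume st: "0 \<le> s" "s \<le> t" "t \<le> T"
    show "norm (x t - x s) \<le> max C1 C2 * (t - s) powr \<alpha>"
    proof (cases "s = t")
      case False
      then have pos: "0 < t - s" using st by simp
      show ?thesis
      proof (cases "t - s \<le> 1 / 2 ^ n0")
        case True
        obtain m0 where "(1 / 2) ^ m0 < t - s" using real_arch_pow_inv[OF pos, of "1 / 2"] by auto
        then have ex: "\<exists>m. 1 / 2 ^ m < t - s" by (auto simp: power_one_over)
        \<comment> \<open>Choose the level \<open>n\<close> with \<open>1 / 2 ^ Suc n < t - s \<le> 1 / 2 ^ n\<close>.\<close>
        define m where "m = (LEAST m. 1 / 2 ^ m < t - s)"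
        have m: "1 / 2 ^ m < t - s" unfolding m_def by (rule LeastI_ex[OF ex])
        have "n0 < m"
        proof (rule ccontr)
          assume "\<not> n0 < m"
          then have "1 / 2 ^ n0 \<le> 1 / (2::real) ^ m" by (intro divide_left_mono power_increasing) auto
          then show False using m True by linarith
        qed
        then obtain n where n: "m = Suc n" "n0 \<le> n" by (cases m) auto
        have "t - s \<le> 1 / 2 ^ n" using not_less_Least[of n "\<lambda>m. 1 / 2 ^ m < t - s"] n unfolding m_def[symmetric] by auto
        then have *: "\<bar>x t - x s\<bar> \<le> (2 / (1 - \<rho>) + 1) * \<rho> ^ n" using near n st by blast
        have "\<rho> ^ n = (1 / 2 ^ n) powr \<alpha>"
          by (simp add: \<rho>_def powr_minus powr_divide powr_realpow[symmetric] powr_powr mult.commute power_inverse field_simps)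
        also have "(1 / 2 ^ n) powr \<alpha> \<le> (2 * (t - s)) powr \<alpha>"
          using m n \<alpha> by (intro powr_mono2) (auto simp: field_simps)
        also have "\<dots> = 2 powr \<alpha> * (t - s) powr \<alpha>" by (rule powr_mult)
        finally have "(2 / (1 - \<rho>) + 1) * \<rho> ^ n \<le> (2 / (1 - \<rho>) + 1) * (2 powr \<alpha> * (t - s) powr \<alpha>)"
          using \<rho> by (intro mult_left_mono) auto
        with * have "\<bar>x t - x s\<bar> \<le> C1 * (t - s) powr \<alpha>" by (simp add: C1_def mult.assoc)
        also have "\<dots> \<le> max C1 C2 * (t - s) powr \<alpha>" by (intro mult_right_mono) auto
        finally show ?thesis by simp
      next
        case False
        have "\<bar>x t - x s\<bar> \<le> 2 * Mx" using Mx[of s] Mx[of t] st by auto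
        also have "\<dots> \<le> 2 * Mx * (2 ^ n0 * (t - s)) powr \<alpha>"
        proof -
          have "1 \<le> (2 ^ n0 * (t - s)) powr \<alpha>" using False \<alpha> by (intro ge_one_powr_ge_zero) (auto simp: field_simps)
          moreover have "0 \<le> 2 * Mx" using Mx[of s] st by auto
          ultimately show ?thesis using mult_left_mono by fastforce
        qed
        also have "(2 ^ n0 * (t - s)) powr \<alpha> = (2 ^ n0) powr \<alpha> * (t - s) powr \<alpha>" by (rule powr_mult)
        finally have "\<bar>x t - x s\<bar> \<le> C2 * (t - s) powr \<alpha>" by (simp add: C2_def mult_ac)
        also have "\<dots> \<le> max C1 C2 * (t - s) powr \<alpha>" by (intro mult_right_mono) auto
        finally show ?thesis by simp
      qed
    qed simp
  qed
  then show ?thesis ..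
qed

text \<open>By Markov's inequality a single increment over a grid interval of level \<open>n\<close> exceeds \<open>2 powr (- \<alpha> * n)\<close> with
probability of order \<open>2 powr (n * (2 * m * \<alpha> - q))\<close>. There are of order \<open>2 ^ n\<close> of them, so the
probability that any does is summable in \<open>n\<close> exactly because \<open>1 + 2 * m * \<alpha> < q\<close>, and the Borel--Cantelli
lemma applies.\<close>

lemma (in prob_space) kolmogorov_continuity:
  fixes b :: "real \<Rightarrow> 'a \<Rightarrow> real"
  assumes \<alpha>: "0 < \<alpha>" and q: "1 + 2 * real m * \<alpha> < q"
    and meas: "\<And>t. 0 \<le> t \<Longrightarrow> b t \<in> borel_measurable M"
    and cont: "AE \<omega> in M. continuous_on {0..T} (\<lambda>t. b t \<omega>)"
    and int: "\<And>s t. \<lbrakk>0 \<le> s; s < t\<rbrakk> \<Longrightarrow> integrable M (\<lambda>\<omega>. (b t \<omega> - b s \<omega>) ^ (2 * m))"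
    and mom: "\<And>s t. \<lbrakk>0 \<le> s; s < t\<rbrakk> \<Longrightarrow> expectation (\<lambda>\<omega>. (b t \<omega> - b s \<omega>) ^ (2 * m)) \<le> c * (t - s) powr q"
  shows "AE \<omega> in M. \<exists>C. holder_with C \<alpha> T (\<lambda>t. b t \<omega>)"
proof -
  obtain L :: nat where L: "T \<le> real L" using real_arch_simple by blast
  define \<rho> where "\<rho> = 2 powr - \<alpha>"
  have \<rho>: "0 < \<rho>" by (simp add: \<rho>_def)
  define D where "D n k \<omega> = (b (real (Suc k) / 2 ^ n) \<omega> - b (real k / 2 ^ n) \<omega>) ^ (2 * m)" for n k :: nat and \<omega>
  define A where "A n = (\<Union>k<L * 2 ^ n. {\<omega> \<in> space M. (\<rho> ^ n) ^ (2 * m) \<le> D n k \<omega>})" for n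
  have D_meas [measurable]: "D n k \<in> borel_measurable M" for n k
    unfolding D_def by (intro borel_measurable_power borel_measurable_diff meas) auto
  have A_sets: "A n \<in> sets M" for n unfolding A_def by measurable
  have pr: "prob {\<omega> \<in> space M. (\<rho> ^ n) ^ (2 * m) \<le> D n k \<omega>} \<le> c * (2 powr (2 * real m * \<alpha> - q)) ^ n" for n k
  proof -
    have lt: "real k / 2 ^ n < real (Suc k) / 2 ^ n" by (simp add: divide_strict_right_mono)
    have "prob {\<omega> \<in> space M. (\<rho> ^ n) ^ (2 * m) \<le> D n k \<omega>} \<le> expectation (D n k) / (\<rho> ^ n) ^ (2 * m)"
      using int[OF _ lt] \<rho> by (intro integral_Markov_inequality_measure[of _ _ "{}"]) (auto simp: D_def)
    also have "\<dots> \<le> c * (real (Suc k) / 2 ^ n - real k / 2 ^ n) powr q / (\<rho> ^ n) ^ (2 * m)"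
      unfolding D_def using \<rho> by (intro divide_right_mono mom lt) auto
    also have "\<dots> = c * (2 powr (2 * real m * \<alpha> - q)) ^ n"
    proof -
      have 1: "real (Suc k) / 2 ^ n - real k / 2 ^ n = 2 powr - real n"
        by (simp add: field_simps powr_minus powr_realpow)
      have 2: "(\<rho> ^ n) ^ (2 * m) = 2 powr (- \<alpha> * real n * real (2 * m))"
        unfolding \<rho>_def by (simp add: powr_powr powr_realpow[symmetric] mult.assoc del: of_nat_mult)
      have "(2 powr (2 * real m * \<alpha> - q)) ^ n = 2 powr ((2 * real m * \<alpha> - q) * real n)"
        by (simp add: powr_realpow[symmetric] powr_powr)
      moreover have "(2 * real m * \<alpha> - q) * real n = - real n * q - - \<alpha> * real n * real (2 * m)"
        by (simp add: algebra_simps)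
      ultimately show ?thesis unfolding 1 2 by (simp only: powr_powr powr_diff times_divide_eq_right)
    qed
    finally show ?thesis .
  qed
  have c: "0 \<le> c" 
  proof -
    have "0 \<le> expectation (\<lambda>\<omega>. (b 1 \<omega> - b 0 \<omega>) ^ (2 * m))" by (intro integral_nonneg_AE) auto
    also have "\<dots> \<le> c" using mom[of 0 1] by simp
    finally show ?thesis .
  qed
  have sum_bound: "measure M (A n) \<le> real L * c * (2 powr (1 + 2 * real m * \<alpha> - q)) ^ n" for n
  proof -
    have "measure M (A n) \<le> (\<Sum>k<L * 2 ^ n. prob {\<omega> \<in> space M. (\<rho> ^ n) ^ (2 * m) \<le> D n k \<omega>})"
      unfolding A_def by (intro finite_measure_subadditive_finite) auto
    also have "\<dots> \<le> (\<Sum>k<L * 2 ^ n. c * (2 powr (2 * real m * \<alpha> - q)) ^ n)" by (intro sum_mono pr)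
    also have "\<dots> = real L * c * (2 * 2 powr (2 * real m * \<alpha> - q)) ^ n" by (simp add: power_mult_distrib)
    also have "2 * 2 powr (2 * real m * \<alpha> - q) = 2 powr (1 + 2 * real m * \<alpha> - q)"
      using powr_add[of 2 1 "2 * real m * \<alpha> - q"] by (simp add: algebra_simps)
    finally show ?thesis .
  qed
  have "2 powr (1 + 2 * real m * \<alpha> - q) < 1" using q by (simp add: powr_less_one)
  then have "summable (\<lambda>n. real L * c * (2 powr (1 + 2 * real m * \<alpha> - q)) ^ n)"
    by (intro summable_mult summable_geometric) auto
  then have "summable (\<lambda>n. measure M (A n))"
    by (rule summable_comparison_test') (use sum_bound in auto)
  then have "AE \<omega> in M. \<forall>\<^sub>F n in sequentially. \<omega> \<in> space M - A n"
    using A_sets by (intro borel_cantelli_AE1) (auto simp: less_top[symmetric])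
  then show ?thesis using cont
  proof eventually_elim
    case (elim \<omega>)
    then obtain n0 where n0: "\<And>n. n0 \<le> n \<Longrightarrow> \<omega> \<in> space M - A n" by (auto simp: eventually_sequentially)
    show ?case
    proof (rule dyadic_chaining[OF \<alpha> elim(2)])
      fix n k assume n: "n0 \<le> n" and k: "real (Suc k) \<le> T * 2 ^ n"
      have "T * 2 ^ n \<le> real L * 2 ^ n" using L by simp
      then have "real (Suc k) \<le> real (L * 2 ^ n)" using order_trans[OF k] by simp
      then have "k < L * 2 ^ n" unfolding of_nat_le_iff by simp
      then have "D n k \<omega> < (\<rho> ^ n) ^ (2 * m)" using n0[OF n] by (auto simp: A_def not_le)
      then have "\<bar>b (real (Suc k) / 2 ^ n) \<omega> - b (real k / 2 ^ n) \<omega>\<bar> ^ (2 * m) < (\<rho> ^ n) ^ (2 * m)"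
        by (simp add: D_def power_even_abs)
      from power_less_imp_less_base[OF this]
      have "\<bar>b (real (Suc k) / 2 ^ n) \<omega> - b (real k / 2 ^ n) \<omega>\<bar> < \<rho> ^ n" using \<rho> by simp
      then show "\<bar>b (real (Suc k) / 2 ^ n) \<omega> - b (real k / 2 ^ n) \<omega>\<bar> \<le> (2 powr - \<alpha>) ^ n"
        unfolding \<rho>_def by (rule less_imp_le)
    qed
  qed
qed

text \<open>The positive variance excludes the degenerate alternative in \<open>gaussian_rv\<close>.\<close>

lemma (in prob_space) centered_gaussian_even_moment:
  assumes Z: "gaussian_rv M Z" and mean: "expectation Z = 0"
    and var: "expectation (\<lambda>\<omega>. (Z \<omega>)\<^sup>2) = v" "0 < v"
  shows "integrable M (\<lambda>\<omega>. Z \<omega> ^ (2 * m))"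
    and "expectation (\<lambda>\<omega>. Z \<omega> ^ (2 * m)) = fact (2 * m) / (2 ^ m * fact m) * v ^ m"
proof -
  have [measurable]: "Z \<in> borel_measurable M" using Z by (simp add: gaussian_rv_def)
  have "\<not> (AE \<omega> in M. Z \<omega> = \<mu>)" for \<mu>
  proof
    assume ae: "AE \<omega> in M. Z \<omega> = \<mu>"
    have "expectation Z = expectation (\<lambda>_. \<mu>)" using ae by (intro integral_cong_AE) auto
    then have "\<mu> = 0" using mean by (simp add: prob_space)
    have "expectation (\<lambda>\<omega>. (Z \<omega>)\<^sup>2) = expectation (\<lambda>_. \<mu>\<^sup>2)" using ae by (intro integral_cong_AE) auto
    then show False using var \<open>\<mu> = 0\<close> by simp
  qed
  then obtain \<mu> \<sigma> where \<sigma>: "0 < \<sigma>" and D: "distributed M lborel Z (normal_density \<mu> \<sigma>)"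
    using Z by (auto simp: gaussian_rv_def)
  have E: "expectation (\<lambda>\<omega>. h (Z \<omega>)) = (\<integral>x. normal_density \<mu> \<sigma> x * h x \<partial>lborel)"
    if "h \<in> borel_measurable borel" for h
    using distributed_integral[OF D, of h] that by simp
  have "\<mu> = 0" using E[of "\<lambda>x. x"] mean integral_normal_moment_nz_1[OF \<sigma>] by simp
  have "v = \<sigma>\<^sup>2"
    using E[of "\<lambda>x. x\<^sup>2"] var(1) integral_normal_moment_even[OF \<sigma>, of 0 1] by (simp add: \<open>\<mu> = 0\<close>)
  then have "expectation (\<lambda>\<omega>. Z \<omega> ^ (2 * m)) = fact (2 * m) / ((2 / v) ^ m * fact m)"
    using E[of "\<lambda>x. x ^ (2 * m)"] integral_normal_moment_even[OF \<sigma>, of 0 m] by (simp add: \<open>\<mu> = 0\<close>)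
  then show "expectation (\<lambda>\<omega>. Z \<omega> ^ (2 * m)) = fact (2 * m) / (2 ^ m * fact m) * v ^ m"
    using var(2) by (simp add: power_divide field_simps)
  show "integrable M (\<lambda>\<omega>. Z \<omega> ^ (2 * m))"
    using distributed_integrable[OF D, of "\<lambda>x. x ^ (2 * m)"] integrable_normal_moment[OF \<sigma>, of 0 "2 * m"]
    by (simp add: \<open>\<mu> = 0\<close>)
qed

lemma (in prob_space) gaussian_square_integrable:
  assumes Z: "gaussian_rv M Z"
  shows "integrable M (\<lambda>\<omega>. (Z \<omega>)\<^sup>2)"
proof -
  have [measurable]: "Z \<in> borel_measurable M" using Z by (simp add: gaussian_rv_def)
  consider \<mu> \<sigma> where "0 < \<sigma>" "distributed M lborel Z (normal_density \<mu> \<sigma>)"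
    | \<mu> where "AE \<omega> in M. Z \<omega> = \<mu>" using Z by (auto simp: gaussian_rv_def)
  then show ?thesis
  proof cases
    case 1
    have "integrable M (\<lambda>\<omega>. Z \<omega> - \<mu>)" "integrable M (\<lambda>\<omega>. (Z \<omega> - \<mu>)\<^sup>2)"
      using distributed_integrable[OF 1(2), of "\<lambda>x. x - \<mu>"] integrable_normal_moment[OF 1(1), of \<mu> 1]
        distributed_integrable[OF 1(2), of "\<lambda>x. (x - \<mu>)\<^sup>2"] integrable_normal_moment[OF 1(1), of \<mu> 2] by auto
    then have "integrable M (\<lambda>\<omega>. (Z \<omega> - \<mu>)\<^sup>2 + 2 * \<mu> * (Z \<omega> - \<mu>) + \<mu>\<^sup>2)" by simp
    then show ?thesis by (simp add: power2_eq_square algebra_simps)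
  next
    case 2
    then have "integrable M (\<lambda>\<omega>. (Z \<omega>)\<^sup>2) = integrable M (\<lambda>_. \<mu>\<^sup>2)" by (intro integrable_cong_AE) auto
    then show ?thesis by simp
  qed
qed

lemma fBm_gaussian_combination:
  "fBm M H b \<Longrightarrow> finite F \<Longrightarrow> F \<subseteq> {0..} \<Longrightarrow> gaussian_rv M (\<lambda>\<omega>. \<Sum>u\<in>F. c u * b u \<omega>)"
  by (simp add: fBm_def gaussian_process_def)

lemma fBm_gaussian: "fBm M H b \<Longrightarrow> 0 \<le> u \<Longrightarrow> gaussian_rv M (b u)"
  using fBm_gaussian_combination[of M H b "{u}" "\<lambda>_. 1"] by simp

lemma (in prob_space) fBm_increment_moments:
  assumes b: "fBm M H b" and st: "0 \<le> s" "s < t"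
  shows "integrable M (\<lambda>\<omega>. (b t \<omega> - b s \<omega>) ^ (2 * m))"
    and "expectation (\<lambda>\<omega>. (b t \<omega> - b s \<omega>) ^ (2 * m))
      = fact (2 * m) / (2 ^ m * fact m) * (t - s) powr (2 * real m * H)"
proof -
  note G = fBm_gaussian[OF b]
  have [measurable]: "b t \<in> borel_measurable M" "b s \<in> borel_measurable M"
    using G st by (auto simp: gaussian_rv_def)
  have sq: "integrable M (\<lambda>\<omega>. (b t \<omega>)\<^sup>2)" "integrable M (\<lambda>\<omega>. (b s \<omega>)\<^sup>2)"
    using gaussian_square_integrable G st by auto
  have int: "integrable M (b t)" "integrable M (b s)"
    using sq by (auto intro: square_integrable_imp_integrable)
  have prod: "integrable M (\<lambda>\<omega>. b s \<omega> * b t \<omega>)"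
  proof (rule Bochner_Integration.integrable_bound)
    show "integrable M (\<lambda>\<omega>. (b s \<omega>)\<^sup>2 + (b t \<omega>)\<^sup>2)" using sq by simp
    have "\<bar>x * y\<bar> \<le> x\<^sup>2 + y\<^sup>2" for x y :: real
    proof -
      have "2 * \<bar>x * y\<bar> \<le> x\<^sup>2 + y\<^sup>2"
        using sum_squares_bound[of "\<bar>x\<bar>" "\<bar>y\<bar>"] by (simp add: abs_mult)
      then show ?thesis using abs_ge_zero[of "x * y"] by linarith
    qed
    then show "AE \<omega> in M. norm (b s \<omega> * b t \<omega>) \<le> norm ((b s \<omega>)\<^sup>2 + (b t \<omega>)\<^sup>2)" by simp
  qed simp
  have cov: "expectation (\<lambda>\<omega>. b u \<omega> * b v \<omega>) =
      (v powr (2 * H) + u powr (2 * H) - \<bar>v - u\<bar> powr (2 * H)) / 2" if "0 \<le> u" "0 \<le> v" for u v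
    using b that by (simp add: fBm_def)
  let ?Z = "\<lambda>\<omega>. b t \<omega> - b s \<omega>"
  have "?Z = (\<lambda>\<omega>. \<Sum>u\<in>{s, t}. (if u = t then 1 else - 1) * b u \<omega>)" using st by (auto simp: fun_eq_iff)
  moreover have "gaussian_rv M (\<lambda>\<omega>. \<Sum>u\<in>{s, t}. (if u = t then 1 else - 1) * b u \<omega>)"
    using st by (intro fBm_gaussian_combination[OF b]) auto
  ultimately have gauss: "gaussian_rv M ?Z" by simp
  have mean: "expectation ?Z = 0" using b int st by (simp add: fBm_def)
  have "expectation (\<lambda>\<omega>. (?Z \<omega>)\<^sup>2) = expectation (\<lambda>\<omega>. (b t \<omega>)\<^sup>2 + (b s \<omega>)\<^sup>2 - 2 * (b s \<omega> * b t \<omega>))"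
    by (intro Bochner_Integration.integral_cong) (auto simp: power2_eq_square algebra_simps)
  also have "\<dots> = expectation (\<lambda>\<omega>. (b t \<omega>)\<^sup>2) + expectation (\<lambda>\<omega>. (b s \<omega>)\<^sup>2) - 2 * expectation (\<lambda>\<omega>. b s \<omega> * b t \<omega>)"
    using sq prod by simp
  also have "\<dots> = (t - s) powr (2 * H)"
    using cov[of t t] cov[of s s] cov[of s t] st by (simp add: power2_eq_square)
  finally have var: "expectation (\<lambda>\<omega>. (?Z \<omega>)\<^sup>2) = (t - s) powr (2 * H)" .
  have v: "0 < (t - s) powr (2 * H)" using st by simp
  show "integrable M (\<lambda>\<omega>. ?Z \<omega> ^ (2 * m))"
    by (rule centered_gaussian_even_moment(1)[OF gauss mean var v])
  have "((t - s) powr (2 * H)) ^ m = (t - s) powr (2 * real m * H)"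
    using v by (simp add: powr_realpow[symmetric] powr_powr mult_ac)
  then show "expectation (\<lambda>\<omega>. ?Z \<omega> ^ (2 * m)) = fact (2 * m) / (2 ^ m * fact m) * (t - s) powr (2 * real m * H)"
    using centered_gaussian_even_moment(2)[OF gauss mean var v, of m] by simp
qed

text \<open>The moment of order \<open>2 * m\<close> of an increment scales with exponent \<open>2 * m * H\<close>; the loss of \<open>1\<close> in the
exponent that the union bound costs becomes negligible for large \<open>m\<close>.\<close>

lemma (in prob_space) fBm_holder:
  assumes b: "fBm M H b" and \<alpha>: "0 < \<alpha>" "\<alpha> < H"
  shows "AE \<omega> in M. \<exists>C. holder_with C \<alpha> T (\<lambda>t. b t \<omega>)"
proof -
  obtain m :: nat where "1 / (2 * (H - \<alpha>)) < real m" using reals_Archimedean2 by blast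
  then have m: "1 + 2 * real m * \<alpha> < 2 * real m * H" using \<alpha> by (simp add: field_simps)
  show ?thesis
  proof (rule kolmogorov_continuity[OF \<alpha>(1) m, where c = "fact (2 * m) / (2 ^ m * fact m)"])
    show "b t \<in> borel_measurable M" if "0 \<le> t" for t
      using fBm_gaussian[OF b that] by (simp add: gaussian_rv_def)
    show "AE \<omega> in M. continuous_on {0..T} (\<lambda>t. b t \<omega>)"
      using b unfolding fBm_def by (auto elim!: eventually_mono intro: continuous_on_subset)
  qed (use fBm_increment_moments[OF b] in auto)
qed

section \<open>Dependence of the integrals on a parameter\<close>

lemma finite_uniform_bound:
  fixes P :: "'i::finite \<Rightarrow> real \<Rightarrow> bool"
  assumes "\<And>i. \<exists>c. P i c" "\<And>i c d. P i c \<Longrightarrow> c \<le> d \<Longrightarrow> P i d"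
  shows "\<exists>c\<ge>0. \<forall>i. P i c"
proof -
  obtain c where c: "\<And>i. P i (c i)" using assms(1) by metis
  have "P i (max 0 (Max (range c)))" for i
    by (rule assms(2)[OF c[of i]]) (simp add: le_max_iff_disj)
  then show ?thesis by (intro exI[of _ "max 0 (Max (range c))"]) auto
qed

lemma holder_with_identity:
  assumes "\<alpha> \<le> 1"
  shows "holder_with (T powr (1 - \<alpha>)) \<alpha> T (\<lambda>s. s)"
proof (rule holder_withI)
  fix s t :: real assume st: "0 \<le> s" "s \<le> t" "t \<le> T"
  have "t - s = (t - s) powr (1 - \<alpha>) * (t - s) powr \<alpha>" using st by (cases "s = t") (auto simp: powr_add[symmetric])
  also have "\<dots> \<le> T powr (1 - \<alpha>) * (t - s) powr \<alpha>"
    using st assms by (intro mult_right_mono powr_mono2) auto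
  finally show "norm (t - s) \<le> T powr (1 - \<alpha>) * (t - s) powr \<alpha>" using st by simp
qed

text \<open>Only countably many parameters can be handled on one event of probability one, so the equation is
known for rational parameters alone. By the a priori bound those solutions have a common Hoelder constant
for all parameters below \<open>b\<close>; continuity in the parameter passes it to every real parameter. This alone
makes the integrals exist at arbitrary parameters and depend continuously on them.\<close>

lemma parametric_young_integrals:
  fixes F :: "'i::finite \<Rightarrow> 'a::banach \<Rightarrow> 'a" and g :: "'i \<Rightarrow> real \<Rightarrow> real"
    and x :: "real \<Rightarrow> real \<Rightarrow> 'a"
  assumes \<alpha>: "1 / 2 < \<alpha>"
    and F: "\<And>i p. norm (F i p) \<le> S" "\<And>i p q. dist (F i p) (F i q) \<le> L * dist p q" "0 \<le> L"
    and g: "\<And>i. holder_with G \<alpha> T (g i)" "0 \<le> G"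
    and w: "\<And>i y. 0 < y \<Longrightarrow> y \<le> b \<Longrightarrow> \<bar>w y i\<bar> \<le> W" "0 \<le> W"
    and sol: "\<And>q. q \<in> \<rat> \<Longrightarrow> 0 < q \<Longrightarrow> \<exists>C. holder_with C \<alpha> T (x q)"
       "\<And>q. q \<in> \<rat> \<Longrightarrow> 0 < q \<Longrightarrow> solves_system T x0 (w q) F g (x q)"
    and cont: "\<And>t. \<lbrakk>0 \<le> t; t \<le> T\<rbrakk> \<Longrightarrow> continuous_on {0<..} (\<lambda>y. x y t)"
    and t: "0 \<le> t" "t \<le> T"
  shows "\<And>y. 0 < y \<Longrightarrow> y < b \<Longrightarrow> has_RS_integral (\<lambda>s. F i (x y s)) (g i) 0 t (RS_integral (\<lambda>s. F i (x y s)) (g i) 0 t)"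
    and "\<And>y. 0 < y \<Longrightarrow> y < b \<Longrightarrow> riemann_sum (\<lambda>s. F i (x y s)) (g i) t \<longlonglongrightarrow> RS_integral (\<lambda>s. F i (x y s)) (g i) 0 t"
    and "continuous_on {0<..<b} (\<lambda>y. RS_integral (\<lambda>s. F i (x y s)) (g i) 0 t)"
proof -
  obtain D where D: "0 \<le> D"
    "\<And>w x0 x C. \<forall>i. \<bar>w i\<bar> \<le> W \<Longrightarrow> holder_with C \<alpha> T x \<Longrightarrow> solves_system T x0 w F g x \<Longrightarrow> holder_with D \<alpha> T x"
    using a_priori_holder_bound[where F = F and g = g, OF \<alpha> F g w(2)] by blast
  have lim_x: "(\<lambda>k. x (u k) s) \<longlonglongrightarrow> x y s"
    if "u \<longlonglongrightarrow> y" "0 < y" "\<And>k. 0 < u k" "0 \<le> s" "s \<le> T" for u :: "nat \<Rightarrow> real" and y s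
    using continuous_on_tendsto_compose[OF cont[OF that(4,5)] that(1)] that(2,3) by auto
  have rat: "holder_with D \<alpha> T (x q)" if q: "q \<in> \<rat>" "0 < q" "q \<le> b" for q
  proof -
    obtain C where "holder_with C \<alpha> T (x q)" using sol(1)[OF q(1,2)] by blast
    then show ?thesis using D(2)[OF allI[OF w(1)[OF q(2,3)]] _ sol(2)[OF q(1,2)]] by blast
  qed
  have holder: "holder_with D \<alpha> T (x y)" if y: "0 < y" "y < b" for y
  proof -
    \<comment> \<open>Rational parameters decreasing to \<open>y\<close> that stay below \<open>b\<close>.\<close>
    have "\<exists>q\<in>\<rat>. y < q \<and> q < min b (y + 1 / real (Suc k))" for k
      using y by (intro Rats_dense_in_real) auto
    then obtain q where q: "\<And>k. q k \<in> \<rat>" "\<And>k. y < q k" "\<And>k. q k < b" "\<And>k. q k < y + 1 / real (Suc k)"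
      by (metis min_less_iff_conj)
    have "q \<longlonglongrightarrow> y"
    proof (rule real_tendsto_sandwich[where f = "\<lambda>_. y" and h = "\<lambda>k. y + 1 / real (Suc k)"])
      show "(\<lambda>k. y + 1 / real (Suc k)) \<longlonglongrightarrow> y"
        using tendsto_add[OF tendsto_const LIMSEQ_Suc[OF lim_1_over_n], of y] by simp
    qed (use q in \<open>auto intro!: always_eventually less_imp_le simp del: of_nat_Suc\<close>)
    moreover have "0 < q k" for k using q(2)[of k] y by linarith
    ultimately have "(\<lambda>k. x (q k) s) \<longlonglongrightarrow> x y s" if "0 \<le> s" "s \<le> T" for s
      using lim_x y(1) that by blast
    moreover have "holder_with D \<alpha> T (x (q k))" for k
      by (rule rat[OF q(1) \<open>0 < q k\<close> less_imp_le[OF q(3)]])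
    ultimately show ?thesis by (rule holder_with_tendsto[rotated])
  qed
  have LD: "0 \<le> L * D" using F(3) D(1) by simp
  have holder_F: "holder_with (L * D) \<alpha> T (\<lambda>s. F i (x y s))" if y: "0 < y" "y < b" for y i
    by (rule holder_with_compose[OF F(2,3) holder[OF y]])
  show "has_RS_integral (\<lambda>s. F i (x y s)) (g i) 0 t (RS_integral (\<lambda>s. F i (x y s)) (g i) 0 t)"
    if y: "0 < y" "y < b" for y
    by (rule young_integrable[OF \<alpha> LD g(2) holder_F[OF y] g(1) t])
  show "riemann_sum (\<lambda>s. F i (x y s)) (g i) t \<longlonglongrightarrow> RS_integral (\<lambda>s. F i (x y s)) (g i) 0 t"
    if y: "0 < y" "y < b" for y
    by (rule riemann_sum_tendsto[OF \<alpha> LD g(2) holder_F[OF y] g(1) t])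
  have F_cont: "continuous_on UNIV (F i)" for i
  proof (rule uniformly_continuous_imp_continuous, rule lipschitz_on_uniformly_continuous)
    show "L-lipschitz_on UNIV (F i)" using F(2,3) by (intro lipschitz_onI) auto
  qed
  show "continuous_on {0<..<b} (\<lambda>y. RS_integral (\<lambda>s. F i (x y s)) (g i) 0 t)"
    unfolding continuous_on_sequentially comp_def
  proof (intro ballI allI impI; elim conjE)
    fix y u assume y: "y \<in> {0<..<b}" and u: "\<forall>k. u k \<in> {0<..<b}" "u \<longlonglongrightarrow> y"
    show "(\<lambda>k. RS_integral (\<lambda>s. F i (x (u k) s)) (g i) 0 t) \<longlonglongrightarrow> RS_integral (\<lambda>s. F i (x y s)) (g i) 0 t"
    proof (rule RS_integral_limit[OF \<alpha> LD g(2,1) holder_F holder_F _ t])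
      fix s assume s: "0 \<le> s" "s \<le> T"
      have "(\<lambda>k. x (u k) s) \<longlonglongrightarrow> x y s" using u y s by (intro lim_x) auto
      then show "(\<lambda>k. F i (x (u k) s)) \<longlonglongrightarrow> F i (x y s)"
        by (intro continuous_on_tendsto_compose[OF F_cont]) auto
    qed (use y u in auto)
  qed
qed

section \<open>Differential equations driven by a path and by time\<close>

lemma bounded_derivative_imp_lipschitz:
  fixes f :: "'a::real_normed_vector \<Rightarrow> 'b::real_normed_vector"
  assumes "\<And>x. (f has_derivative blinfun_apply (f' x)) (at x)" "bounded (range f')"
  shows "\<exists>L\<ge>0. \<forall>p q. dist (f p) (f q) \<le> L * dist p q"
proof -
  obtain L where L: "\<And>x. norm (f' x) \<le> L" using assms(2) by (auto simp: bounded_iff)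
  then have "0 \<le> L" using order_trans[OF norm_ge_zero] by blast
  moreover have "dist (f p) (f q) \<le> L * dist p q" for p q
    unfolding dist_norm
    by (rule differentiable_bound[of UNIV f "\<lambda>x. blinfun_apply (f' x)"])
      (use assms(1) L in \<open>auto simp: norm_blinfun.rep_eq[symmetric]\<close>)
  ultimately show ?thesis by blast
qed

lemma Cb1_bounded_lipschitz:
  assumes "Cb1 f"
  obtains S L where "\<And>p. norm (f p) \<le> S" "0 \<le> L" "\<And>p q. dist (f p) (f q) \<le> L * dist p q"
proof -
  obtain S where "\<And>p. norm (f p) \<le> S" using assms by (auto simp: Cb1_def bounded_iff)
  moreover obtain L where "L \<ge> 0" "\<forall>p q. dist (f p) (f q) \<le> L * dist p q"
    using assms bounded_derivative_imp_lipschitz[of f] unfolding Cb1_def by blast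
  ultimately show thesis using that by blast
qed

lemma Cb2_imp_Cb1: "Cb2 f \<Longrightarrow> Cb1 f"
proof -
  assume "Cb2 f"
  then obtain f' where f': "\<forall>x. (f has_derivative blinfun_apply (f' x)) (at x)" "Cb1 f'" and b: "bounded (range f)"
    by (auto simp: Cb2_def)
  then have "continuous_on UNIV f'"
    by (intro continuous_at_imp_continuous_on) (auto simp: Cb1_def intro: has_derivative_continuous)
  with f' b show "Cb1 f" by (auto simp: Cb1_def)
qed

text \<open>Time is treated as an additional driving path: the index \<open>None\<close> stands for the drift with integrator \<open>s\<close>
and weight \<open>1\<close>, and \<open>Some j\<close> for the \<open>j\<close>-th noise component with weight \<open>sqrt y\<close>.\<close>

definition augmented_field :: "('a \<Rightarrow> 'a) \<Rightarrow> ('d \<Rightarrow> 'a \<Rightarrow> 'a) \<Rightarrow> 'd option \<Rightarrow> 'a \<Rightarrow> 'a" where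
  "augmented_field V0 V = case_option V0 V"

definition augmented_path :: "(real \<Rightarrow> real ^ 'd) \<Rightarrow> 'd option \<Rightarrow> real \<Rightarrow> real" where
  "augmented_path b = case_option (\<lambda>s. s) (\<lambda>j s. b s $ j)"

definition augmented_weight :: "real \<Rightarrow> 'd option \<Rightarrow> real" where
  "augmented_weight y = case_option 1 (\<lambda>_. sqrt y)"

lemmas augmented_defs = augmented_field_def augmented_path_def augmented_weight_def

lemma young_solution_solves_system:
  fixes V0 :: "real ^ 'n \<Rightarrow> real ^ 'n" and V :: "'d::finite \<Rightarrow> real ^ 'n \<Rightarrow> real ^ 'n"
  assumes sol: "young_solution T x0 V0 V b y x"
    and \<alpha>: "1 / 2 < \<alpha>" "\<alpha> \<le> 1" and V0: "\<And>p q. dist (V0 p) (V0 q) \<le> L * dist p q" "0 \<le> L"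
    and x: "holder_with C \<alpha> T x"
  shows "solves_system T x0 (augmented_weight y) (augmented_field V0 V) (augmented_path b) x"
  unfolding solves_system_def
proof
  fix t assume t: "t \<in> {0..T}"
  have "holder_with (max C 0) \<alpha> T x" by (rule holder_with_mono[OF x]) simp
  from holder_with_compose[OF V0 this] have "holder_with (L * max C 0) \<alpha> T (\<lambda>s. V0 (x s))" .
  then have "has_RS_integral (\<lambda>s. V0 (x s)) (\<lambda>s. s) 0 t (RS_integral (\<lambda>s. V0 (x s)) (\<lambda>s. s) 0 t)"
    using t V0(2) by (intro young_integrable[OF \<alpha>(1) _ _ _ holder_with_identity[OF \<alpha>(2)]]) auto
  then have "integral {0..t} (\<lambda>s. V0 (x s)) = RS_integral (\<lambda>s. V0 (x s)) (\<lambda>s. s) 0 t"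
    by (intro integral_unique has_RS_integral_identity)
  then show "x t = x0 + (\<Sum>i\<in>UNIV. augmented_weight y i *\<^sub>R
      RS_integral (\<lambda>s. augmented_field V0 V i (x s)) (augmented_path b i) 0 t)"
    using sol t
    by (simp add: young_solution_def augmented_defs UNIV_option_conv sum.reindex scaleR_sum_right)
qed

text \<open>The deterministic core of the theorem, for one fixed path of the driving process.\<close>

lemma young_solution_family:
  fixes V0 :: "real ^ 'n \<Rightarrow> real ^ 'n" and V :: "'d::finite \<Rightarrow> real ^ 'n \<Rightarrow> real ^ 'n"
    and x :: "real \<Rightarrow> real \<Rightarrow> real ^ 'n"
  assumes \<alpha>: "1 / 2 < \<alpha>" "\<alpha> \<le> 1" and V: "Cb1 V0" "\<And>j. Cb1 (V j)"
    and b: "\<And>j. \<exists>C. holder_with C \<alpha> T (\<lambda>s. b s $ j)"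
    and sol: "\<And>q. \<lbrakk>q \<in> \<rat>; 0 < q\<rbrakk> \<Longrightarrow> (\<exists>C. holder_with C \<alpha> T (x q)) \<and> young_solution T x0 V0 V b q (x q)"
    and cont: "\<And>t. \<lbrakk>0 \<le> t; t \<le> T\<rbrakk> \<Longrightarrow> continuous_on {0<..} (\<lambda>y. x y t)"
    and t: "0 \<le> t" "t \<le> T"
  defines "I i y \<equiv> RS_integral (\<lambda>s. augmented_field V0 V i (x y s)) (augmented_path b i) 0 t"
  shows "0 < y \<Longrightarrow> has_RS_integral (\<lambda>s. augmented_field V0 V i (x y s)) (augmented_path b i) 0 t (I i y)"
    and "0 < y \<Longrightarrow> riemann_sum (\<lambda>s. augmented_field V0 V i (x y s)) (augmented_path b i) t \<longlonglongrightarrow> I i y"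
    and "continuous_on {0<..} (I i)"
proof -
  let ?F = "augmented_field V0 V" and ?g = "augmented_path b"
  have Cb: "Cb1 (?F i)" for i using V by (cases i) (auto simp: augmented_defs)
  have "\<exists>S\<ge>0. \<forall>i. \<forall>p. norm (?F i p) \<le> S"
    by (rule finite_uniform_bound) (use Cb1_bounded_lipschitz[OF Cb] in \<open>metis, meson order_trans\<close>)
  then obtain S where S: "\<And>i p. norm (?F i p) \<le> S" by blast
  have "\<exists>L\<ge>0. \<forall>i. \<forall>p q. dist (?F i p) (?F i q) \<le> L * dist p q"
    by (rule finite_uniform_bound)
      (use Cb1_bounded_lipschitz[OF Cb] in \<open>metis, meson order_trans mult_right_mono zero_le_dist\<close>)
  then obtain L where L: "\<And>i p q. dist (?F i p) (?F i q) \<le> L * dist p q" "0 \<le> L" by blast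
  have "\<exists>G\<ge>0. \<forall>i. holder_with G \<alpha> T (?g i)"
  proof (rule finite_uniform_bound)
    show "\<exists>G. holder_with G \<alpha> T (?g i)" for i
      using b holder_with_identity[OF \<alpha>(2)] by (cases i) (auto simp: augmented_defs)
  qed (rule holder_with_mono)
  then obtain G where G: "\<And>i. holder_with G \<alpha> T (?g i)" "0 \<le> G" by blast
  \<comment> \<open>Bounds uniform in the parameter are only available for bounded parameters, so continuity is shown on each \<open>{0<..<b}\<close>.\<close>
  have weight: "\<bar>augmented_weight y i\<bar> \<le> max 1 (sqrt b')" if "0 < y" "y \<le> b'" for y b' and i :: "'d option"
    using that by (cases i) (auto simp: augmented_defs le_max_iff_disj)
  have V0_L: "dist (V0 p) (V0 q) \<le> L * dist p q" for p q
    using L(1)[of None] by (simp add: augmented_defs)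
  have solves: "solves_system T x0 (augmented_weight q) ?F ?g (x q)" if q: "q \<in> \<rat>" "0 < q" for q
    using sol[OF q] young_solution_solves_system[OF _ \<alpha> V0_L L(2)] by blast
  note family = parametric_young_integrals[where F = ?F and g = ?g, OF \<alpha>(1) S L G weight _ _ solves cont t]
  show "has_RS_integral (\<lambda>s. ?F i (x y s)) (?g i) 0 t (I i y)" if "0 < y"
    unfolding I_def by (rule family(1)[of "y + 1"]) (use that sol in auto)
  show "riemann_sum (\<lambda>s. ?F i (x y s)) (?g i) t \<longlonglongrightarrow> I i y" if "0 < y"
    unfolding I_def by (rule family(2)[of "y + 1"]) (use that sol in auto)
  have "continuous_on (\<Union>b'. {0<..<b'}) (I i)"
    unfolding I_def by (intro continuous_on_open_UN family(3)) (use sol in auto)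
  moreover have "(\<Union>b'. {0<..<b'}) = {0::real<..}"
    by (auto intro: gt_ex)
  ultimately show "continuous_on {0<..} (I i)" by simp
qed

section \<open>Evaluation at a random parameter\<close>

text \<open>A pathwise continuous family is its own version, except that on the exceptional null set it need not
be measurable. Multiplying by the indicator of a measurable set of full measure repairs this: the
product is a limit of the measurable \<open>R N y\<close> everywhere.\<close>

lemma evaluated_atI:
  fixes Z :: "real \<Rightarrow> 'w \<Rightarrow> 'b::euclidean_space"
  assumes good: "AE \<omega> in M. continuous_on {0<..} (\<lambda>y. Z y \<omega>) \<and> (\<forall>y>0. (\<lambda>N. R N y \<omega>) \<longlonglongrightarrow> Z y \<omega>)"
    and meas: "\<And>N y. 0 < y \<Longrightarrow> R N y \<in> borel_measurable M"
  shows "evaluated_at M Z Y (\<lambda>\<omega>. Z (Y \<omega>) \<omega>)"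
proof -
  obtain N0 where N0: "N0 \<in> null_sets M"
    "{\<omega> \<in> space M. \<not> (continuous_on {0<..} (\<lambda>y. Z y \<omega>) \<and> (\<forall>y>0. (\<lambda>N. R N y \<omega>) \<longlonglongrightarrow> Z y \<omega>))} \<subseteq> N0"
    using good unfolding eventually_ae_filter by blast
  define A where "A = space M - N0"
  have A [measurable]: "A \<in> sets M" using N0(1) by (auto simp: A_def)
  have ae: "AE \<omega> in M. \<omega> \<in> A" using AE_not_in[OF N0(1)] AE_space by eventually_elim (simp add: A_def)
  have on_A: "continuous_on {0<..} (\<lambda>y. Z y \<omega>)" "\<And>y. 0 < y \<Longrightarrow> (\<lambda>N. R N y \<omega>) \<longlonglongrightarrow> Z y \<omega>" if "\<omega> \<in> A" for \<omega>
    using N0(2) that unfolding A_def by blast+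
  define Z' where "Z' y \<omega> = indicat_real A \<omega> *\<^sub>R Z y \<omega>" for y \<omega>
  have "Z' y \<in> borel_measurable M" if y: "0 < y" for y
  proof (rule borel_measurable_LIMSEQ_metric)
    show "(\<lambda>\<omega>. indicat_real A \<omega> *\<^sub>R R N y \<omega>) \<in> borel_measurable M" for N
      using meas[OF y] by measurable
    show "(\<lambda>N. indicat_real A \<omega> *\<^sub>R R N y \<omega>) \<longlonglongrightarrow> Z' y \<omega>" for \<omega>
      using on_A(2)[OF _ y, of \<omega>] by (cases "\<omega> \<in> A") (auto simp: Z'_def)
  qed
  moreover have "AE \<omega> in M. Z' y \<omega> = Z y \<omega>" for y using ae by eventually_elim (simp add: Z'_def)
  moreover have "AE \<omega> in M. continuous_on {0<..} (\<lambda>y. Z' y \<omega>)"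
    using ae by eventually_elim (use on_A(1) in \<open>simp add: Z'_def\<close>)
  moreover have "AE \<omega> in M. Z' (Y \<omega>) \<omega> = Z (Y \<omega>) \<omega>" using ae by eventually_elim (simp add: Z'_def)
  ultimately show ?thesis unfolding evaluated_at_def continuous_version_def by blast
qed

text \<open>A law with a density has no atom at \<open>0\<close>. Positivity is what places \<open>Y\<close> in the range of parameters for which
the equation is posed.\<close>

lemma M_Wright_positive:
  assumes "M_Wright_distributed M \<beta> Y"
  shows "AE \<omega> in M. 0 < Y \<omega>"
proof (cases "\<beta> = 1")
  case True
  then have "AE \<omega> in M. Y \<omega> = 1" using assms by (simp add: M_Wright_distributed_def)
  then show ?thesis by eventually_elim simp
next
  case False
  then obtain m where m: "distributed M lborel Y m" using assms by (auto simp: M_Wright_distributed_def)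
  have "AE x in lborel. x \<noteq> (0::real)" by (rule AE_lborel_singleton)
  then have "AE x in density lborel m. x \<noteq> 0"
    using distributed_borel_measurable[OF m] by (subst AE_density) (auto elim: eventually_mono)
  then have "AE x in distr M lborel Y. x \<noteq> 0" unfolding distributed_distr_eq_density[OF m] .
  then have "AE \<omega> in M. Y \<omega> \<noteq> 0" by (rule AE_distrD[OF distributed_measurable[OF m]])
  moreover have "AE \<omega> in M. 0 \<le> Y \<omega>" using assms by (simp add: M_Wright_distributed_def)
  ultimately show ?thesis by eventually_elim simp
qed

theorem proposition5:
  fixes M :: "'w measure" and T H \<beta> \<kappa> :: real
    and x0 :: "real ^ 'n"
    and V0 :: "real ^ 'n \<Rightarrow> real ^ 'n"
    and V :: "'d::finite \<Rightarrow> real ^ 'n \<Rightarrow> real ^ 'n"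
    and B :: "real \<Rightarrow> 'w \<Rightarrow> real ^ 'd"
    and Y :: "'w \<Rightarrow> real"
    and X :: "real \<Rightarrow> real \<Rightarrow> 'w \<Rightarrow> real ^ 'n"
  assumes "prob_space M"
    and "T > 0" and "1 / 2 < H" and "H < 1" and "0 < \<beta>" and "\<beta> \<le> 1"
    and "1 - H < \<kappa>" and "\<kappa> < 1 / 2"
    and "Cb1 V0" and "\<forall>j. Cb2 (V j)"
    and "fBm_vec M H B"
    and "M_Wright_distributed M \<beta> Y"
    and "indep_of_process M Y B"
    and X_rv: "\<forall>y>0. \<forall>t\<in>{0..T}. X y t \<in> borel_measurable M"
    and X_solution: "\<forall>y>0. AE \<omega> in M. holder_on (1 - \<kappa>) {0..T} (\<lambda>t. X y t \<omega>) \<and>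
          young_solution T x0 V0 V (\<lambda>t. B t \<omega>) y (\<lambda>t. X y t \<omega>)"
    and X_cont: "AE \<omega> in M. \<forall>t\<in>{0..T}. continuous_on {0<..} (\<lambda>y. X y t \<omega>)"
  shows "\<forall>t\<in>{0..T}.
     (\<forall>j. (AE \<omega> in M. RS_integrable (\<lambda>s. V j (X (Y \<omega>) s \<omega>)) (\<lambda>s. B s \<omega> $ j) 0 t) \<and>
        evaluated_at M (\<lambda>y \<omega>. RS_integral (\<lambda>s. V j (X y s \<omega>)) (\<lambda>s. B s \<omega> $ j) 0 t) Y
          (\<lambda>\<omega>. RS_integral (\<lambda>s. V j (X (Y \<omega>) s \<omega>)) (\<lambda>s. B s \<omega> $ j) 0 t)) \<and>
     (AE \<omega> in M. (\<lambda>s. V0 (X (Y \<omega>) s \<omega>)) integrable_on {0..t}) \<and>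
     evaluated_at M (\<lambda>y \<omega>. integral {0..t} (\<lambda>s. V0 (X y s \<omega>))) Y
       (\<lambda>\<omega>. integral {0..t} (\<lambda>s. V0 (X (Y \<omega>) s \<omega>)))"
proof -
  interpret prob_space M by fact
  \<comment> \<open>A single exponent serves both the solutions and the driving paths, as \<open>\<alpha> < H\<close>.\<close>
  define \<alpha> where "\<alpha> = 1 - \<kappa>"
  have \<alpha>: "1 / 2 < \<alpha>" "\<alpha> \<le> 1" "0 < \<alpha>" "\<alpha> < H" using assms(3,4,7,8) by (auto simp: \<alpha>_def)
  have Cb: "Cb1 V0" "\<And>j. Cb1 (V j)" using assms(9,10) Cb2_imp_Cb1 by auto
  have fBm: "fBm M H (\<lambda>t \<omega>. B t \<omega> $ j)" for j using assms(11) by (simp add: fBm_vec_def)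
  \<comment> \<open>\<open>?I\<close> are the integrals and \<open>?R\<close> their Riemann sums, for the drift and all noise components at once.\<close>
  let ?F = "augmented_field V0 V" and ?g = "\<lambda>\<omega>. augmented_path (\<lambda>t. B t \<omega>)"
  let ?I = "\<lambda>i t y \<omega>. RS_integral (\<lambda>s. ?F i (X y s \<omega>)) (?g \<omega> i) 0 t"
  let ?R = "\<lambda>i t N y \<omega>. riemann_sum (\<lambda>s. ?F i (X y s \<omega>)) (?g \<omega> i) t N"
  have "AE \<omega> in M. \<forall>j. \<exists>C. holder_with C \<alpha> T (\<lambda>t. B t \<omega> $ j)"
    by (intro eventually_all_finite fBm_holder[OF fBm \<alpha>(3,4)])
  moreover have "AE \<omega> in M. \<forall>q\<in>{q \<in> \<rat>. 0 < q}. (\<exists>C. holder_with C \<alpha> T (\<lambda>t. X q t \<omega>)) \<and>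
      young_solution T x0 V0 V (\<lambda>t. B t \<omega>) q (\<lambda>t. X q t \<omega>)"
  proof (rule AE_ball_countable')
    show "countable {q \<in> \<rat>. 0 < (q::real)}" by (rule countable_subset[OF _ countable_rat]) auto
  qed (use X_solution in \<open>auto simp: holder_on_def holder_with_def \<alpha>_def\<close>)
  ultimately have good: "AE \<omega> in M. \<forall>t\<in>{0..T}. \<forall>i.
      (\<forall>y>0. has_RS_integral (\<lambda>s. ?F i (X y s \<omega>)) (?g \<omega> i) 0 t (?I i t y \<omega>)) \<and>
      continuous_on {0<..} (\<lambda>y. ?I i t y \<omega>) \<and> (\<forall>y>0. (\<lambda>N. ?R i t N y \<omega>) \<longlonglongrightarrow> ?I i t y \<omega>)"
    using X_cont
  proof eventually_elim
    case (elim \<omega>)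
    show ?case
    proof (intro ballI allI)
      fix t i assume "t \<in> {0..T}"
      then have t: "0 \<le> t" "t \<le> T" by auto
      note fam = young_solution_family[where x = "\<lambda>y t. X y t \<omega>" and b = "\<lambda>t. B t \<omega>" and i = i, OF \<alpha>(1,2) Cb _ _ _ t]
      show "(\<forall>y>0. has_RS_integral (\<lambda>s. ?F i (X y s \<omega>)) (?g \<omega> i) 0 t (?I i t y \<omega>)) \<and>
          continuous_on {0<..} (\<lambda>y. ?I i t y \<omega>) \<and> (\<forall>y>0. (\<lambda>N. ?R i t N y \<omega>) \<longlonglongrightarrow> ?I i t y \<omega>)"
        using elim by (intro conjI allI impI fam) auto
    qed
  qed
  have meas: "?R i t N y \<in> borel_measurable M" if t: "t \<in> {0..T}" and y: "0 < y" for i t N y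
  proof -
    have grid: "t * real k / real N \<in> {0..T}" if "k \<le> N" "0 < N" for k
    proof -
      have "t * real k \<le> t * real N" using that t by (intro mult_left_mono) auto
      also have "\<dots> \<le> T * real N" using t by (intro mult_right_mono) auto
      finally show ?thesis using that t by (simp add: divide_le_eq)
    qed
    have F: "?F i \<in> borel_measurable borel"
    proof (rule borel_measurable_continuous_onI)
      have "Cb1 (?F i)" using Cb by (cases i) (auto simp: augmented_defs)
      then show "continuous_on UNIV (?F i)"
        by (intro continuous_at_imp_continuous_on) (auto simp: Cb1_def intro: has_derivative_continuous)
    qed
    have g: "(\<lambda>\<omega>. ?g \<omega> i s) \<in> borel_measurable M" if "s \<in> {0..T}" for s
      using fBm_gaussian[OF fBm, of s] that by (cases i) (auto simp: augmented_defs gaussian_rv_def)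
    show ?thesis
      unfolding riemann_sum_def
    proof (intro borel_measurable_sum borel_measurable_scaleR borel_measurable_diff)
      fix k assume k: "k \<in> {..<N}"
      show "(\<lambda>\<omega>. ?g \<omega> i (t * real (Suc k) / real N)) \<in> borel_measurable M"
        "(\<lambda>\<omega>. ?g \<omega> i (t * real k / real N)) \<in> borel_measurable M"
        using k by (auto intro!: g grid simp del: of_nat_Suc)
      have "X y (t * real k / real N) \<in> borel_measurable M" using X_rv y grid[of k] k by auto
      then show "(\<lambda>\<omega>. ?F i (X y (t * real k / real N) \<omega>)) \<in> borel_measurable M"
        by (rule measurable_compose[OF _ F])
    qed
  qed
  have pos: "AE \<omega> in M. 0 < Y \<omega>" using assms(12) by (rule M_Wright_positive)
  show ?thesis
  proof (intro ballI conjI allI)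
    fix t assume t: "t \<in> {0..T}"
    show "AE \<omega> in M. RS_integrable (\<lambda>s. V j (X (Y \<omega>) s \<omega>)) (\<lambda>s. B s \<omega> $ j) 0 t" for j
      using good pos
    proof eventually_elim
      case (elim \<omega>)
      then have "has_RS_integral (\<lambda>s. ?F (Some j) (X (Y \<omega>) s \<omega>)) (?g \<omega> (Some j)) 0 t (?I (Some j) t (Y \<omega>) \<omega>)"
        using t by blast
      then show ?case by (auto simp: RS_integrable_def augmented_defs)
    qed
    have "evaluated_at M (?I (Some j) t) Y (\<lambda>\<omega>. ?I (Some j) t (Y \<omega>) \<omega>)" for j
      by (rule evaluated_atI[where R = "?R (Some j) t"]) (use good t meas in \<open>auto elim!: eventually_mono\<close>)
    then show "evaluated_at M (\<lambda>y \<omega>. RS_integral (\<lambda>s. V j (X y s \<omega>)) (\<lambda>s. B s \<omega> $ j) 0 t) Y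
          (\<lambda>\<omega>. RS_integral (\<lambda>s. V j (X (Y \<omega>) s \<omega>)) (\<lambda>s. B s \<omega> $ j) 0 t)" for j
      by (simp add: augmented_defs)
    have good0: "AE \<omega> in M. (\<forall>y>0. ((\<lambda>s. V0 (X y s \<omega>)) has_integral ?I None t y \<omega>) {0..t}) \<and>
        continuous_on {0<..} (\<lambda>y. ?I None t y \<omega>) \<and> (\<forall>y>0. (\<lambda>N. ?R None t N y \<omega>) \<longlonglongrightarrow> ?I None t y \<omega>)"
      using good
    proof eventually_elim
      case (elim \<omega>)
      have "((\<lambda>s. V0 (X y s \<omega>)) has_integral ?I None t y \<omega>) {0..t}" if "0 < y" for y
      proof (rule has_RS_integral_identity)
        have "has_RS_integral (\<lambda>s. ?F None (X y s \<omega>)) (?g \<omega> None) 0 t (?I None t y \<omega>)"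
          using elim t that by blast
        then show "has_RS_integral (\<lambda>s. V0 (X y s \<omega>)) (\<lambda>s. s) 0 t (?I None t y \<omega>)"
          by (simp add: augmented_defs)
      qed
      then show ?case using elim t by blast
    qed
    show "AE \<omega> in M. (\<lambda>s. V0 (X (Y \<omega>) s \<omega>)) integrable_on {0..t}"
      using good0 pos by eventually_elim (blast intro: has_integral_integrable)
    show "evaluated_at M (\<lambda>y \<omega>. integral {0..t} (\<lambda>s. V0 (X y s \<omega>))) Y
       (\<lambda>\<omega>. integral {0..t} (\<lambda>s. V0 (X (Y \<omega>) s \<omega>)))"
    proof (rule evaluated_atI[where R = "?R None t"])
      show "AE \<omega> in M. continuous_on {0<..} (\<lambda>y. integral {0..t} (\<lambda>s. V0 (X y s \<omega>))) \<and>
          (\<forall>y>0. (\<lambda>N. ?R None t N y \<omega>) \<longlonglongrightarrow> integral {0..t} (\<lambda>s. V0 (X y s \<omega>)))"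
        using good0
      proof eventually_elim
        case (elim \<omega>)
        then have eq: "integral {0..t} (\<lambda>s. V0 (X y s \<omega>)) = ?I None t y \<omega>" if "0 < y" for y
          using that by (blast intro: integral_unique)
        have "continuous_on {0<..} (\<lambda>y. integral {0..t} (\<lambda>s. V0 (X y s \<omega>))) = continuous_on {0<..} (\<lambda>y. ?I None t y \<omega>)"
          by (rule continuous_on_cong) (auto simp: eq)
        then show ?case using elim eq by auto
      qed
    qed (rule meas[OF t])
  qed
qed

end
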